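(* Let $P\in\mathrm H$ and $Q\in\mathrm{SP}$ be arbitrary. Then $T(P;x,y)=T(Q;x,y)$ if and only if $P\cong Q$ (isomorphism of posets).
   Context: All posets are finite and all graphs are finite, simple and undirected. A poset is identified with its ground set; $|P|$ is its size; $\mathbf 1$ is the one-element poset. Sums. For posets $P,Q$ with disjoint ground sets, the direct sum $P+Q$ is the poset on $P\cup Q$ with $x\le y$ iff ($x,y\in P$ and $x\le y$ in $P$) or ($x,y\in Q$ and $x\le y$ in $Q$). The ordinal sum $P\oplus Q$ is the poset on $P\cup Q$ with $x\le y$ iff ($x,y\in P$ and $x\le y$ in $P$) or ($x,y\in Q$ and $x\le y$ in $Q$) or ($x\in P$ and $y\in Q$). Series-parallel posets. A nonempty poset is series-parallel if it can be constructed, up to isomorphism, from $\mathbf 1$ by repeated direct sums and ordinal sums; $\mathrm{SP}$ is the class of all series-parallel posets. Tutte polynomial. An order ideal of $P$ is a subset $I\subseteq P$ such that $u\in I$, $v\in P$, $v\le u$ imply $v\in I$. For $S\subseteq P$ let $\rho_P(S)=\max\{|I|: I\subseteq S,\ I\text{ an order ideal of }P\}$. Then $$T(P;x,y)=\sum_{S\subseteq P}(x-1)^{|P|-\rho_P(S)}(y-1)^{|S|-\rho_P(S)}.$$ The class $\mathrm H$. For $W\subseteq P$, $P[W]$ is the induced subposet on $W$. The comparability graph $G(P)$ has vertex set $P$ and edges $\{s,t\}$ for $s<t$ in $P$; $\overline{G(P)}$ is its complement (the incomparability graph). For a graph $G$ and $W\subseteq V(G)$, $G[W]$ is the induced subgraph,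 and $\mathcal C(G)$ is the set of connected components of $G$. For $P\in\mathrm{SP}$ with $G=G(P)$, let $\mathcal W(P)\subseteq 2^P\setminus\{\varnothing\}$ be the smallest family with respect to inclusion such that $P\in\mathcal W(P)$ and, for every $W\in\mathcal W(P)$ and every $C\in\mathcal C(G[W])\cup\mathcal C(\overline G[W])$, we have $V(C)\in\mathcal W(P)$. The class $\mathrm H$ consists of all $P\in\mathrm{SP}$ such that for every $W\in\mathcal W(P)$, if $G(P[W])$ is disconnected, then for every $C\in\mathcal C(G(P[W]))$ the polynomial $T(P[V(C)];x,y)$ is irreducible in $\mathbb Q[x,y]$. *)

theory Defs
  imports "HOL-Computational_Algebra.Computational_Algebra"
begin

text \<open>A finite poset is a reflexive order relation \<open>P\<close>, with ground set \<^term>\<open>Field P\<close>.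
  The induced subposet on \<open>W\<close> is the library's \<open>Restr P W\<close>, that is \<open>P \<inter> W \<times> W\<close>.\<close>

definition finite_poset :: "'a rel \<Rightarrow> bool" where
  "finite_poset P \<longleftrightarrow> finite (Field P) \<and> partial_order_on (Field P) P"

definition poset_iso :: "'a rel \<Rightarrow> 'b rel \<Rightarrow> bool" where
  "poset_iso P Q \<longleftrightarrow> (\<exists>f. bij_betw f (Field P) (Field Q) \<and>
     (\<forall>a\<in>Field P. \<forall>b\<in>Field P. (a, b) \<in> P \<longleftrightarrow> (f a, f b) \<in> Q))"

lemma poset_iso_iff_iso: "poset_iso P Q \<longleftrightarrow> (\<exists>f. iso P Q f)"
  by (simp add: poset_iso_def iso_iff2)

text \<open>Both sums are only used for posets with disjoint ground sets.\<close>

definition direct_sum :: "'a rel \<Rightarrow> 'a rel \<Rightarrow> 'a rel" where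
  "direct_sum P Q = P \<union> Q"

definition ordinal_sum :: "'a rel \<Rightarrow> 'a rel \<Rightarrow> 'a rel" where
  "ordinal_sum P Q = P \<union> Q \<union> Field P \<times> Field Q"

inductive_set SP :: "'a rel set" where
  one: "{(x, x)} \<in> SP"
| direct: "P \<in> SP \<Longrightarrow> Q \<in> SP \<Longrightarrow> Field P \<inter> Field Q = {} \<Longrightarrow> direct_sum P Q \<in> SP"
| ordinal: "P \<in> SP \<Longrightarrow> Q \<in> SP \<Longrightarrow> Field P \<inter> Field Q = {} \<Longrightarrow> ordinal_sum P Q \<in> SP"
| iso: "P \<in> SP \<Longrightarrow> poset_iso P Q \<Longrightarrow> Q \<in> SP"

lemma finite_poset_iso:
  assumes P: "finite_poset P" and iso: "poset_iso P Q"
  shows "finite_poset Q"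
proof -
  obtain f where f: "bij_betw f (Field P) (Field Q)"
    and rel: "\<And>a b. a \<in> Field P \<Longrightarrow> b \<in> Field P \<Longrightarrow> (a, b) \<in> P \<longleftrightarrow> (f a, f b) \<in> Q"
    using iso unfolding poset_iso_def by blast
  have surj: "\<exists>a\<in>Field P. u = f a" if "u \<in> Field Q" for u
    using f that unfolding bij_betw_def by blast
  have refl: "\<forall>a\<in>Field P. (a, a) \<in> P" and tr: "trans P" and an: "antisym P"
    using P by (auto simp: finite_poset_def order_on_defs refl_on_def)
  have "finite (Field Q)"
    using P f bij_betw_finite unfolding finite_poset_def by blast
  moreover have "refl_on (Field Q) Q"
    unfolding refl_on_def using surj rel refl by metis
  moreover have "trans Q"
  proof (rule transI)
    fix u v w assume uv: "(u, v) \<in> Q" and vw: "(v, w) \<in> Q"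
    have "u \<in> Field Q" "v \<in> Field Q" "w \<in> Field Q"
      using uv vw by (auto intro: FieldI1 FieldI2)
    then obtain a b c where "a \<in> Field P" "b \<in> Field P" "c \<in> Field P" "u = f a" "v = f b" "w = f c"
      by (blast dest: surj)
    then show "(u, w) \<in> Q" using uv vw rel tr by (metis transD)
  qed
  moreover have "antisym Q"
  proof (rule antisymI)
    fix u v assume uv: "(u, v) \<in> Q" and vu: "(v, u) \<in> Q"
    have "u \<in> Field Q" "v \<in> Field Q"
      using uv by (auto intro: FieldI1 FieldI2)
    then obtain a b where "a \<in> Field P" "b \<in> Field P" "u = f a" "v = f b"
      by (blast dest: surj)
    then show "u = v" using uv vu rel an by (metis antisymD)
  qed
  ultimately show ?thesis
    by (auto simp: finite_poset_def order_on_defs intro: FieldI1 FieldI2)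
qed

lemma SP_finite_poset: "P \<in> SP \<Longrightarrow> finite_poset P \<and> Field P \<noteq> {}"
proof (induction rule: SP.induct)
  case (one x)
  then show ?case
    by (auto simp: finite_poset_def order_on_defs refl_on_def trans_def antisym_def Field_def)
next
  case (direct P Q)
  have F: "Field (direct_sum P Q) = Field P \<union> Field Q"
    by (auto simp: direct_sum_def Field_def)
  have sub: "P \<subseteq> Field P \<times> Field P" "Q \<subseteq> Field Q \<times> Field Q"
    by (auto intro: FieldI1 FieldI2)
  have "trans (direct_sum P Q)"
  proof (rule transI)
    fix u v w assume "(u, v) \<in> direct_sum P Q" "(v, w) \<in> direct_sum P Q"
    moreover have "trans P" "trans Q"
      using direct by (auto simp: finite_poset_def order_on_defs)
    ultimately show "(u, w) \<in> direct_sum P Q"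
      using sub direct.hyps unfolding direct_sum_def by (auto dest: transD)
  qed
  moreover have "antisym (direct_sum P Q)"
  proof (rule antisymI)
    fix u v assume "(u, v) \<in> direct_sum P Q" "(v, u) \<in> direct_sum P Q"
    moreover have "antisym P" "antisym Q"
      using direct by (auto simp: finite_poset_def order_on_defs)
    ultimately show "u = v"
      using sub direct.hyps unfolding direct_sum_def by (auto dest: antisymD)
  qed
  ultimately show ?case
    using direct F
    by (auto simp: finite_poset_def order_on_defs refl_on_def direct_sum_def intro: FieldI1 FieldI2)
next
  case (ordinal P Q)
  have F: "Field (ordinal_sum P Q) = Field P \<union> Field Q"
    by (auto simp: ordinal_sum_def Field_def)
  have sub: "P \<subseteq> Field P \<times> Field P" "Q \<subseteq> Field Q \<times> Field Q"
    by (auto intro: FieldI1 FieldI2)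
  have "trans (ordinal_sum P Q)"
  proof (rule transI)
    fix u v w assume "(u, v) \<in> ordinal_sum P Q" "(v, w) \<in> ordinal_sum P Q"
    moreover have "trans P" "trans Q"
      using ordinal by (auto simp: finite_poset_def order_on_defs)
    ultimately show "(u, w) \<in> ordinal_sum P Q"
      using sub ordinal.hyps unfolding ordinal_sum_def by (auto dest: transD)
  qed
  moreover have "antisym (ordinal_sum P Q)"
  proof (rule antisymI)
    fix u v assume "(u, v) \<in> ordinal_sum P Q" "(v, u) \<in> ordinal_sum P Q"
    moreover have "antisym P" "antisym Q"
      using ordinal by (auto simp: finite_poset_def order_on_defs)
    ultimately show "u = v"
      using sub ordinal.hyps unfolding ordinal_sum_def by (auto dest: antisymD)
  qed
  ultimately show ?case
    using ordinal F
    by (auto simp: finite_poset_def order_on_defs refl_on_def ordinal_sum_def intro: FieldI1 FieldI2)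
next
  case (iso P Q)
  then have "Field Q \<noteq> {}"
    unfolding poset_iso_def by (metis bij_betw_empty2)
  with iso finite_poset_iso show ?case by blast
qed

definition order_ideal :: "'a rel \<Rightarrow> 'a set \<Rightarrow> bool" where
  "order_ideal P I \<longleftrightarrow> I \<subseteq> Field P \<and> (\<forall>u\<in>I. \<forall>v\<in>Field P. (v, u) \<in> P \<longrightarrow> v \<in> I)"

definition ideal_rank :: "'a rel \<Rightarrow> 'a set \<Rightarrow> nat" where
  "ideal_rank P S = Max {card I | I. I \<subseteq> S \<and> order_ideal P I}"

text \<open>The ring \<open>\<rat>[x, y]\<close> is \<open>\<rat>[x][y]\<close>.\<close>

abbreviation var_x :: "rat poly poly" where "var_x \<equiv> [:[:0, 1:]:]"
abbreviation var_y :: "rat poly poly" where "var_y \<equiv> [:0, 1:]"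

text \<open>The subtractions in the exponents do not truncate:
  the rank of \<open>S\<close> is at most \<open>card S\<close>.\<close>

definition tutte :: "'a rel \<Rightarrow> rat poly poly" where
  "tutte P = (\<Sum>S\<in>Pow (Field P).
     (var_x - 1) ^ (card (Field P) - ideal_rank P S) * (var_y - 1) ^ (card S - ideal_rank P S))"

text \<open>A simple graph is a pair of a vertex set and a set of two-element subsets of it.\<close>

type_synonym 'a sgraph = "'a set \<times> 'a set set"

definition comparability_graph :: "'a rel \<Rightarrow> 'a sgraph" where
  "comparability_graph P = (Field P, {{s, t} | s t. (s, t) \<in> P \<and> s \<noteq> t})"

definition complement_graph :: "'a sgraph \<Rightarrow> 'a sgraph" where
  "complement_graph G =
     (fst G, {{s, t} | s t. s \<in> fst G \<and> t \<in> fst G \<and> s \<noteq> t \<and> {s, t} \<notin> snd G})"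

definition induced_subgraph :: "'a sgraph \<Rightarrow> 'a set \<Rightarrow> 'a sgraph" where
  "induced_subgraph G W = (W, {e \<in> snd G. e \<subseteq> W})"

definition reachable :: "'a sgraph \<Rightarrow> 'a rel" where
  "reachable G = {(u, v). {u, v} \<in> snd G}\<^sup>*"

text \<open>Components are given by their vertex sets \<open>V(C)\<close>, the only part of them that is used.\<close>

definition components :: "'a sgraph \<Rightarrow> 'a set set" where
  "components G = fst G // reachable G"

definition connected_graph :: "'a sgraph \<Rightarrow> bool" where
  "connected_graph G \<longleftrightarrow> fst G \<noteq> {} \<and> (\<forall>u\<in>fst G. \<forall>v\<in>fst G. (u, v) \<in> reachable G)"

inductive_set component_family :: "'a rel \<Rightarrow> 'a set set" for P :: "'a rel" where
  top: "Field P \<in> component_family P"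
| step: "W \<in> component_family P \<Longrightarrow>
    C \<in> components (induced_subgraph (comparability_graph P) W)
      \<union> components (induced_subgraph (complement_graph (comparability_graph P)) W) \<Longrightarrow>
    C \<in> component_family P"

definition class_H :: "'a rel set" where
  "class_H = {P \<in> SP. \<forall>W\<in>component_family P.
     \<not> connected_graph (comparability_graph (Restr P W)) \<longrightarrow>
     (\<forall>C\<in>components (comparability_graph (Restr P W)). irreducible (tutte (Restr P C)))}"

end

theory Submission
  imports Defs "HOL-Library.Disjoint_Sets" "HOL-Computational_Algebra.Field_as_Ring"
begin

text \<open>
  With \<open>q = card (Field Q)\<close>, the Tutte polynomial satisfies \<open>T(P + Q) = T(P) T(Q)\<close> and
  \<open>T(P \<oplus> Q) = ((x - 1) y)\<^sup>q (T(P) - 1) + T(Q)\<close>. It determines for each \<open>k\<close> the number of filters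
  with \<open>k\<close> elements. A direct sum of two nonempty posets has at least two filters of every
  intermediate size, while \<open>P \<oplus> Q\<close> has exactly one of size \<open>q\<close>. So \<open>T\<close> tells direct from ordinal
  sums and reveals where an ordinal sum can be cut, and since \<open>x - 1\<close> divides \<open>T(P) - 1\<close> while
  \<open>T(Q)\<close> has \<open>x\<close>-degree at most \<open>q\<close>, both \<open>T(P)\<close> and \<open>T(Q)\<close> can be recovered. If \<open>P\<close> is
  disconnected with irreducible component polynomials and \<open>Q = A + B\<close>, unique factorization makes
  \<open>T(A)\<close> and \<open>T(B)\<close> the polynomials of complementary unions of components of \<open>P\<close>; the units are \<open>1\<close>
  because every Tutte polynomial is \<open>1\<close> modulo \<open>x - 1\<close>. Induction on the size finishes the proof.
\<close>

section \<open>Ground sets of sums and the order axioms\<close>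

lemma Field_direct_sum [simp]: "Field (direct_sum P Q) = Field P \<union> Field Q"
  by (auto simp: direct_sum_def Field_def)

lemma Field_ordinal_sum [simp]: "Field (ordinal_sum P Q) = Field P \<union> Field Q"
  by (auto simp: ordinal_sum_def Field_def)

lemma finite_poset_finite: "finite_poset P \<Longrightarrow> finite (Field P)"
  by (simp add: finite_poset_def)

lemma finite_poset_refl: "finite_poset P \<Longrightarrow> a \<in> Field P \<Longrightarrow> (a, a) \<in> P"
  by (auto simp: finite_poset_def order_on_defs refl_on_def)

lemma finite_poset_trans: "finite_poset P \<Longrightarrow> (a, b) \<in> P \<Longrightarrow> (b, c) \<in> P \<Longrightarrow> (a, c) \<in> P"
  by (auto simp: finite_poset_def order_on_defs dest: transD)

subsection \<open>Tutte polynomials of sums\<close>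

text \<open>The union of all order ideals contained in \<open>S\<close>, which is the largest such
  ideal when \<open>P\<close> is a finite poset. It turns the maximum in \<open>ideal_rank\<close>
  into the cardinality of an explicit set, so that ranks in sums can be computed by set
  equations.\<close>

definition ideal_interior :: "'a rel \<Rightarrow> 'a set \<Rightarrow> 'a set" where
  "ideal_interior P S = {u \<in> Field P. \<forall>v. (v, u) \<in> P \<longrightarrow> v \<in> S}"

lemma ideal_interior_subset: "finite_poset P \<Longrightarrow> ideal_interior P S \<subseteq> S"
  by (auto simp: ideal_interior_def finite_poset_refl)

lemma ideal_rank_eq_card:
  assumes "finite_poset P"
  shows "ideal_rank P S = card (ideal_interior P S)"
proof -
  let ?R = "{card I | I. I \<subseteq> S \<and> order_ideal P I}"
  have fin: "finite (Field P)" using assms by (rule finite_poset_finite)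
  have I: "I \<subseteq> ideal_interior P S" if "I \<subseteq> S" "order_ideal P I" for I
    using that by (fastforce simp: order_ideal_def ideal_interior_def intro: FieldI1)
  have fin_int: "finite (ideal_interior P S)"
    using fin by (simp add: ideal_interior_def)
  have "order_ideal P (ideal_interior P S)"
    using finite_poset_trans[OF assms] by (auto simp: order_ideal_def ideal_interior_def)
  then have mem: "card (ideal_interior P S) \<in> ?R"
    using ideal_interior_subset[OF assms] by blast
  have ub: "n \<le> card (ideal_interior P S)" if "n \<in> ?R" for n
    using that I fin_int by (auto intro: card_mono)
  have "finite ?R"
    by (rule finite_subset[of _ "{..card (ideal_interior P S)}"]) (use ub in blast, simp)
  then show ?thesis
    unfolding ideal_rank_def using mem ub by (intro Max_eqI) auto
qed

section \<open>Isomorphisms of sums, and invariance of the Tutte polynomial\<close>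

lemma poset_iso_combine:
  assumes f: "bij_betw f A C" and g: "bij_betw g B D" and "A \<inter> B = {}" "C \<inter> D = {}"
  shows "\<exists>h. bij_betw h (A \<union> B) (C \<union> D) \<and> (\<forall>a\<in>A. h a = f a) \<and> (\<forall>b\<in>B. h b = g b)"
proof -
  define h where "h x = (if x \<in> A then f x else g x)" for x
  have "bij_betw h A C" using f by (subst bij_betw_cong[of A h f]) (simp_all add: h_def)
  moreover have hB: "\<forall>b\<in>B. h b = g b" using assms(3) by (auto simp: h_def)
  then have "bij_betw h B D" using g by (subst bij_betw_cong[of B h g]) simp_all
  ultimately have "bij_betw h (A \<union> B) (C \<union> D)" using assms(4) bij_betw_combine by blast
  moreover have "\<forall>a\<in>A. h a = f a" by (simp add: h_def)
  ultimately show ?thesis using hB by blast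
qed

lemma
  assumes "poset_iso P P'" "poset_iso Q Q'"
    and disj: "Field P \<inter> Field Q = {}" "Field P' \<inter> Field Q' = {}"
  shows poset_iso_direct_sum: "poset_iso (direct_sum P Q) (direct_sum P' Q')"
    and poset_iso_ordinal_sum: "poset_iso (ordinal_sum P Q) (ordinal_sum P' Q')"
proof -
  obtain f where f: "bij_betw f (Field P) (Field P')"
    and relf: "\<And>a b. a \<in> Field P \<Longrightarrow> b \<in> Field P \<Longrightarrow> (a, b) \<in> P \<longleftrightarrow> (f a, f b) \<in> P'"
    using assms(1) unfolding poset_iso_def by blast
  obtain g where g: "bij_betw g (Field Q) (Field Q')"
    and relg: "\<And>a b. a \<in> Field Q \<Longrightarrow> b \<in> Field Q \<Longrightarrow> (a, b) \<in> Q \<longleftrightarrow> (g a, g b) \<in> Q'"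
    using assms(2) unfolding poset_iso_def by blast
  obtain h where h: "bij_betw h (Field P \<union> Field Q) (Field P' \<union> Field Q')"
    and hf: "\<And>a. a \<in> Field P \<Longrightarrow> h a = f a" and hg: "\<And>b. b \<in> Field Q \<Longrightarrow> h b = g b"
    using poset_iso_combine[OF f g disj] by blast
  have im: "f a \<in> Field P'" "f a \<notin> Field Q'" if "a \<in> Field P" for a
    using that f disj(2) by (auto dest: bij_betw_apply)
  have im': "g a \<in> Field Q'" "g a \<notin> Field P'" if "a \<in> Field Q" for a
    using that g disj(2) by (auto dest: bij_betw_apply)
  have nP: "(a, b) \<notin> P" "(a, b) \<notin> Q" "(b, a) \<notin> P" "(b, a) \<notin> Q"
    if "a \<in> Field P" "b \<in> Field Q" for a b
    using that disj(1) by (auto dest: FieldI1 FieldI2)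
  have nP2: "(a, b) \<notin> Q" if "a \<in> Field P" for a b
    using that disj(1) by (auto dest: FieldI1 FieldI2)
  have nQ2: "(a, b) \<notin> P" if "a \<in> Field Q" for a b
    using that disj(1) by (auto dest: FieldI1 FieldI2)
  have nP': "(a, b) \<notin> P'" "(a, b) \<notin> Q'" "(b, a) \<notin> P'" "(b, a) \<notin> Q'"
    if "a \<in> Field P'" "b \<in> Field Q'" for a b
    using that disj(2) by (auto dest: FieldI1 FieldI2)
  have nP2': "(a, b) \<notin> Q'" if "a \<in> Field P'" for a b
    using that disj(2) by (auto dest: FieldI1 FieldI2)
  have nQ2': "(a, b) \<notin> P'" if "a \<in> Field Q'" for a b
    using that disj(2) by (auto dest: FieldI1 FieldI2)
  have "(a, b) \<in> direct_sum P Q \<longleftrightarrow> (h a, h b) \<in> direct_sum P' Q'"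
    if "a \<in> Field P \<union> Field Q" "b \<in> Field P \<union> Field Q" for a b
    using that
    by (auto simp: direct_sum_def hf hg relf relg im im' nP nP' nP2 nQ2 nP2' nQ2')
  then show "poset_iso (direct_sum P Q) (direct_sum P' Q')"
    unfolding poset_iso_def using h by auto
  have "(a, b) \<in> ordinal_sum P Q \<longleftrightarrow> (h a, h b) \<in> ordinal_sum P' Q'"
    if "a \<in> Field P \<union> Field Q" "b \<in> Field P \<union> Field Q" for a b
    using that disj(1)
    by (auto simp: ordinal_sum_def hf hg relf relg im im' nP nP' nP2 nQ2 nP2' nQ2')
  then show "poset_iso (ordinal_sum P Q) (ordinal_sum P' Q')"
    unfolding poset_iso_def using h by auto
qed

lemma poset_iso_singleton:
  assumes "finite_poset P" "finite_poset Q" "card (Field P) = 1" "card (Field Q) = 1"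
  shows "poset_iso P Q"
proof -
  obtain x y where xy: "Field P = {x}" "Field Q = {y}"
    using assms(3,4) by (auto simp: card_1_singleton_iff)
  have "(x, x) \<in> P" "(y, y) \<in> Q" using assms(1,2) xy by (auto intro: finite_poset_refl)
  then show ?thesis unfolding poset_iso_def xy
    by (intro exI[of _ "\<lambda>_. y"]) (auto simp: bij_betw_def)
qed

lemma poset_iso_card:
  assumes "finite_poset P" "poset_iso P Q" shows "card (Field P) = card (Field Q)"
  using assms unfolding poset_iso_def by (auto dest: bij_betw_same_card)

text \<open>Taking images under an isomorphism is a bijection between the subsets of the two ground
  sets. It commutes with \<open>ideal_interior\<close>, so the two defining sums agree term by
  term.\<close>

lemma tutte_iso:
  assumes P: "finite_poset P" and iso: "poset_iso P Q"
  shows "tutte P = tutte Q"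
proof -
  have Q: "finite_poset Q" using assms by (rule finite_poset_iso)
  obtain f where f: "bij_betw f (Field P) (Field Q)"
    and rel: "\<And>a b. a \<in> Field P \<Longrightarrow> b \<in> Field P \<Longrightarrow> (a, b) \<in> P \<longleftrightarrow> (f a, f b) \<in> Q"
    using iso unfolding poset_iso_def by blast
  have inj: "inj_on f (Field P)" using f by (simp add: bij_betw_def)
  have im: "f ` Field P = Field Q" using f by (simp add: bij_betw_def)
  have card: "card (Field P) = card (Field Q)" using f by (rule bij_betw_same_card)
  have pow: "bij_betw (image f) (Pow (Field P)) (Pow (Field Q))"
    using f by (rule bij_betw_Pow)
  have inter: "ideal_interior Q (f ` S) = f ` ideal_interior P S" if "S \<subseteq> Field P" for S
  proof -
    have "f u \<in> ideal_interior Q (f ` S) \<longleftrightarrow> u \<in> ideal_interior P S" if u: "u \<in> Field P" for u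
    proof -
      have "v \<in> f ` Field P" if "(v, f u) \<in> Q" for v using that im by (auto dest: FieldI1)
      then have "(\<forall>v. (v, f u) \<in> Q \<longrightarrow> v \<in> f ` S) \<longleftrightarrow> (\<forall>w\<in>Field P. (f w, f u) \<in> Q \<longrightarrow> f w \<in> f ` S)"
        by blast
      also have "\<dots> \<longleftrightarrow> (\<forall>w\<in>Field P. (w, u) \<in> P \<longrightarrow> w \<in> S)"
        using rel u inj_on_image_mem_iff[OF inj _ \<open>S \<subseteq> Field P\<close>] by simp
      also have "\<dots> \<longleftrightarrow> (\<forall>w. (w, u) \<in> P \<longrightarrow> w \<in> S)" by (auto intro: FieldI1)
      finally show ?thesis using u im by (auto simp: ideal_interior_def)
    qed
    moreover have "ideal_interior Q (f ` S) \<subseteq> f ` Field P" "ideal_interior P S \<subseteq> Field P"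
      using im by (auto simp: ideal_interior_def)
    ultimately show ?thesis by blast
  qed
  have "tutte Q = (\<Sum>S\<in>Pow (Field P).
     (var_x - 1) ^ (card (Field Q) - ideal_rank Q (f ` S)) *
     (var_y - 1) ^ (card (f ` S) - ideal_rank Q (f ` S)))"
    unfolding tutte_def by (rule sum.reindex_bij_betw[OF pow, symmetric])
  also have "\<dots> = tutte P" unfolding tutte_def
  proof (rule sum.cong[OF refl])
    fix S assume "S \<in> Pow (Field P)"
    then have S: "S \<subseteq> Field P" by simp
    have "card (f ` S) = card S" using inj S by (meson card_image inj_on_subset)
    moreover have "ideal_rank Q (f ` S) = ideal_rank P S"
      unfolding ideal_rank_eq_card[OF P] ideal_rank_eq_card[OF Q] inter[OF S]
      by (rule card_image) (use inj in \<open>auto simp: ideal_interior_def inj_on_def\<close>)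
    ultimately show "(var_x - 1) ^ (card (Field Q) - ideal_rank Q (f ` S)) *
     (var_y - 1) ^ (card (f ` S) - ideal_rank Q (f ` S)) =
     (var_x - 1) ^ (card (Field P) - ideal_rank P S) * (var_y - 1) ^ (card S - ideal_rank P S)"
      using card by simp
  qed
  finally show ?thesis by simp
qed

section \<open>The Tutte polynomial of a direct sum and of an ordinal sum\<close>

lemma sum_Pow_Un:
  assumes "A \<inter> B = {}"
  shows "(\<Sum>S\<in>Pow (A \<union> B). g S) = (\<Sum>S\<in>Pow A. \<Sum>T\<in>Pow B. g (S \<union> T))"
proof -
  have "bij_betw (\<lambda>(S, T). S \<union> T) (Pow A \<times> Pow B) (Pow (A \<union> B))"
    by (rule bij_betw_byWitness[where f' = "\<lambda>U. (U \<inter> A, U \<inter> B)"]) (use assms in auto)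
  then have "(\<Sum>S\<in>Pow (A \<union> B). g S) = (\<Sum>x\<in>Pow A \<times> Pow B. g (case x of (S, T) \<Rightarrow> S \<union> T))"
    by (rule sum.reindex_bij_betw[symmetric])
  also have "\<dots> = (\<Sum>S\<in>Pow A. \<Sum>T\<in>Pow B. g (S \<union> T))"
    by (simp add: sum.cartesian_product case_prod_unfold)
  finally show ?thesis .
qed

lemma ideal_rank_le:
  assumes "finite_poset P" "S \<subseteq> Field P"
  shows "ideal_rank P S \<le> card S"
proof -
  have "finite S" using assms by (meson finite_poset_finite finite_subset)
  then show ?thesis
    unfolding ideal_rank_eq_card[OF assms(1)]
    using ideal_interior_subset[OF assms(1)] by (rule card_mono)
qed

lemma finite_poset_sums:
  assumes "finite_poset P" "finite_poset Q" "Field P \<inter> Field Q = {}"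
  shows "finite_poset (direct_sum P Q)" "finite_poset (ordinal_sum P Q)"
proof -
  have sub: "P \<subseteq> Field P \<times> Field P" "Q \<subseteq> Field Q \<times> Field Q"
    by (auto intro: FieldI1 FieldI2)
  have t: "trans P" "trans Q" "antisym P" "antisym Q"
    using assms by (auto simp: finite_poset_def order_on_defs)
  have "trans (direct_sum P Q)" "trans (ordinal_sum P Q)"
    unfolding direct_sum_def ordinal_sum_def
    by (rule transI; use sub assms(3) t(1,2) in \<open>auto dest: transD\<close>)+
  moreover have "antisym (direct_sum P Q)" "antisym (ordinal_sum P Q)"
    unfolding direct_sum_def ordinal_sum_def
    by (rule antisymI; use sub assms(3) t(3,4) in \<open>auto dest: antisymD\<close>)+
  moreover have "refl_on (Field P \<union> Field Q) (direct_sum P Q)"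
    "refl_on (Field P \<union> Field Q) (ordinal_sum P Q)"
    using assms(1,2) by (auto simp: refl_on_def direct_sum_def ordinal_sum_def finite_poset_refl)
  ultimately show "finite_poset (direct_sum P Q)" "finite_poset (ordinal_sum P Q)"
    using assms(1,2) unfolding finite_poset_def order_on_defs Field_direct_sum Field_ordinal_sum
    by (auto simp: direct_sum_def ordinal_sum_def intro: FieldI1 FieldI2)
qed

text \<open>The interior of \<open>S \<union> T\<close> is the union of the interiors of
  \<open>S\<close> and \<open>T\<close>. Hence ranks add, each term factors, and the double sum is a
  product of sums.\<close>

lemma tutte_direct_sum:
  assumes P: "finite_poset P" and Q: "finite_poset Q" and disj: "Field P \<inter> Field Q = {}"
  shows "tutte (direct_sum P Q) = tutte P * tutte Q"
proof -
  have PQ: "finite_poset (direct_sum P Q)" using assms by (rule finite_poset_sums)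
  have fin: "finite (Field P)" "finite (Field Q)" using P Q by (auto dest: finite_poset_finite)
  have card: "card (Field P \<union> Field Q) = card (Field P) + card (Field Q)"
    using fin disj by (rule card_Un_disjoint)
  have tm: "(var_x - 1) ^ (card (Field P \<union> Field Q) - ideal_rank (direct_sum P Q) (S \<union> T)) *
     (var_y - 1) ^ (card (S \<union> T) - ideal_rank (direct_sum P Q) (S \<union> T)) =
     ((var_x - 1) ^ (card (Field P) - ideal_rank P S) * (var_y - 1) ^ (card S - ideal_rank P S)) *
     ((var_x - 1) ^ (card (Field Q) - ideal_rank Q T) * (var_y - 1) ^ (card T - ideal_rank Q T))"
    if S: "S \<subseteq> Field P" and T: "T \<subseteq> Field Q" for S T
  proof -
    have "ideal_interior (direct_sum P Q) (S \<union> T) = ideal_interior P S \<union> ideal_interior Q T"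
    proof -
      have "(v, u) \<in> direct_sum P Q \<longleftrightarrow> (v, u) \<in> P" if "u \<in> Field P" for u v
        using that disj by (auto simp: direct_sum_def dest: FieldI1 FieldI2)
      moreover have "(v, u) \<in> direct_sum P Q \<longleftrightarrow> (v, u) \<in> Q" if "u \<in> Field Q" for u v
        using that disj by (auto simp: direct_sum_def dest: FieldI1 FieldI2)
      moreover have "v \<in> S \<union> T \<longleftrightarrow> v \<in> T" if "(v, u) \<in> Q" for u v
        using FieldI1[OF that] S disj by blast
      moreover have "v \<in> S \<union> T \<longleftrightarrow> v \<in> S" if "(v, u) \<in> P" for u v
        using FieldI1[OF that] T disj by blast
      ultimately show ?thesis
        unfolding ideal_interior_def Field_direct_sum by blast
    qed
    moreover have "card (ideal_interior P S \<union> ideal_interior Q T) =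
        card (ideal_interior P S) + card (ideal_interior Q T)"
      by (rule card_Un_disjoint) (use fin disj in \<open>auto simp: ideal_interior_def\<close>)
    ultimately have r: "ideal_rank (direct_sum P Q) (S \<union> T) = ideal_rank P S + ideal_rank Q T"
      by (simp add: ideal_rank_eq_card P Q PQ)
    have c: "card (S \<union> T) = card S + card T"
      by (rule card_Un_disjoint) (use S T fin disj in \<open>auto intro: finite_subset\<close>)
    have le: "ideal_rank P S \<le> card S" "ideal_rank Q T \<le> card T"
      using P Q S T by (auto intro: ideal_rank_le)
    have le2: "card S \<le> card (Field P)" "card T \<le> card (Field Q)"
      using S T fin by (auto intro: card_mono)
    \<comment> \<open>The exponents are natural number differences; they split additively because
      each rank is at most the size of its set, which is at most the size of the ground set.\<close>
    have 1: "card (Field P) + card (Field Q) - (ideal_rank P S + ideal_rank Q T) =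
       (card (Field P) - ideal_rank P S) + (card (Field Q) - ideal_rank Q T)"
      and 2: "card S + card T - (ideal_rank P S + ideal_rank Q T) =
       (card S - ideal_rank P S) + (card T - ideal_rank Q T)"
      using le le2 by linarith+
    show ?thesis
      unfolding card r c 1 2 power_add by (simp only: mult_ac)
  qed
  have "tutte (direct_sum P Q) = (\<Sum>S\<in>Pow (Field P). \<Sum>T\<in>Pow (Field Q).
     ((var_x - 1) ^ (card (Field P) - ideal_rank P S) * (var_y - 1) ^ (card S - ideal_rank P S)) *
     ((var_x - 1) ^ (card (Field Q) - ideal_rank Q T) * (var_y - 1) ^ (card T - ideal_rank Q T)))"
    unfolding tutte_def Field_direct_sum sum_Pow_Un[OF disj]
    by (intro sum.cong refl tm) auto
  also have "\<dots> = tutte P * tutte Q"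
    unfolding tutte_def by (rule sum_product[symmetric])
  finally show ?thesis .
qed

text \<open>The binomial theorem in terms of subsets. With \<open>c\<close> equal to
  \<open>var_y - 1\<close> it produces the powers of \<open>var_y\<close> in the formula for ordinal
  sums.\<close>

lemma sum_Pow_power_card:
  fixes c :: "'a::comm_semiring_1"
  assumes "finite B"
  shows "(\<Sum>T\<in>Pow B. c ^ card T) = (c + 1) ^ card B"
  using assms
proof (induction B)
  case (insert b B)
  have "(\<Sum>T\<in>Pow (insert b B). c ^ card T) =
      (\<Sum>T\<in>Pow B. c ^ card T) + (\<Sum>T\<in>insert b ` Pow B. c ^ card T)"
    unfolding Pow_insert by (rule sum.union_disjoint) (use insert in auto)
  also have "(\<Sum>T\<in>insert b ` Pow B. c ^ card T) = (\<Sum>T\<in>Pow B. c ^ card (insert b T))"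
    by (rule sum.reindex_cong[OF _ refl refl]) (use insert in \<open>auto simp: inj_on_def\<close>)
  also have "\<dots> = (\<Sum>T\<in>Pow B. c * c ^ card T)"
  proof (rule sum.cong[OF refl])
    fix T assume "T \<in> Pow B"
    then have "finite T" "b \<notin> T" using insert finite_subset by blast+
    then show "c ^ card (insert b T) = c * c ^ card T" by simp
  qed
  finally show ?case using insert
    by (simp add: algebra_simps flip: sum_distrib_left)
qed simp

text \<open>All of \<open>P\<close> lies below all of \<open>Q\<close>. If \<open>S\<close> misses a
  point of \<open>P\<close>, no ideal inside \<open>S \<union> T\<close> reaches \<open>Q\<close>,
  so \<open>T\<close> does not affect the rank and summing over \<open>T\<close> gives a factor
  \<open>((x - 1) y) ^ q\<close>, where \<open>q\<close> is the size of \<open>Q\<close>. If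
  \<open>S\<close> is all of \<open>P\<close>, the terms are those of \<open>tutte Q\<close>. The
  \<open>- 1\<close> removes the term of \<open>S = Field P\<close> from
  \<open>tutte P\<close>.\<close>

lemma tutte_ordinal_sum:
  assumes P: "finite_poset P" and Q: "finite_poset Q" and disj: "Field P \<inter> Field Q = {}"
  shows "tutte (ordinal_sum P Q) =
    ((var_x - 1) * var_y) ^ card (Field Q) * (tutte P - 1) + tutte Q"
proof -
  let ?X = "var_x - 1" and ?Y = "var_y - 1"
  let ?p = "card (Field P)" and ?q = "card (Field Q)"
  have PQ: "finite_poset (ordinal_sum P Q)" using assms by (rule finite_poset_sums)
  have fin: "finite (Field P)" "finite (Field Q)" using P Q by (auto dest: finite_poset_finite)
  have card: "card (Field P \<union> Field Q) = card (Field P) + card (Field Q)"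
    using fin disj by (rule card_Un_disjoint)
  have c: "card (S \<union> T) = card S + card T" if S: "S \<subseteq> Field P" and T: "T \<subseteq> Field Q" for S T
    by (rule card_Un_disjoint) (use S T fin disj in \<open>auto intro: finite_subset\<close>)
  let ?t = "\<lambda>U. ?X ^ (card (Field P \<union> Field Q) - ideal_rank (ordinal_sum P Q) U) *
     ?Y ^ (card U - ideal_rank (ordinal_sum P Q) U)"
  let ?tP = "\<lambda>S. ?X ^ (?p - ideal_rank P S) * ?Y ^ (card S - ideal_rank P S)"
  have rP: "ideal_rank P (Field P) = ?p"
  proof -
    have "ideal_interior P (Field P) = Field P"
      by (auto simp: ideal_interior_def intro: FieldI1)
    then show ?thesis by (simp add: ideal_rank_eq_card P)
  qed
  have tm_top: "?t (Field P \<union> T) = ?X ^ (?q - ideal_rank Q T) * ?Y ^ (card T - ideal_rank Q T)"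
    if T: "T \<subseteq> Field Q" for T
  proof -
    have "ideal_interior (ordinal_sum P Q) (Field P \<union> T) = Field P \<union> ideal_interior Q T"
    proof -
      have "(v, u) \<in> ordinal_sum P Q \<longleftrightarrow> (v, u) \<in> P" if "u \<in> Field P" for u v
        using that disj by (auto simp: ordinal_sum_def dest: FieldI1 FieldI2)
      moreover have "(v, u) \<in> ordinal_sum P Q \<longleftrightarrow> (v, u) \<in> Q \<or> v \<in> Field P" if "u \<in> Field Q" for u v
        using that disj by (auto simp: ordinal_sum_def dest: FieldI1 FieldI2)
      moreover have "(v, u) \<in> Q \<Longrightarrow> v \<in> Field P \<longleftrightarrow> False" "(v, u) \<in> P \<Longrightarrow> v \<in> Field P" for u v
        using disj by (auto dest: FieldI1)
      ultimately show ?thesis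
        unfolding ideal_interior_def Field_ordinal_sum by blast
    qed
    moreover have "card (Field P \<union> ideal_interior Q T) = ?p + card (ideal_interior Q T)"
      by (rule card_Un_disjoint) (use fin disj in \<open>auto simp: ideal_interior_def\<close>)
    ultimately have "ideal_rank (ordinal_sum P Q) (Field P \<union> T) = ?p + ideal_rank Q T"
      by (simp add: ideal_rank_eq_card Q PQ)
    then show ?thesis using c[OF subset_refl T] card by simp
  qed
  have tm: "?t (S \<union> T) = ?X ^ ?q * ?Y ^ card T * ?tP S"
    if S: "S \<subseteq> Field P" "S \<noteq> Field P" and T: "T \<subseteq> Field Q" for S T
  proof -
    obtain z where z: "z \<in> Field P" "z \<notin> S" using S by blast
    have "z \<notin> S \<union> T" using z T disj by blast
    then have "u \<notin> ideal_interior (ordinal_sum P Q) (S \<union> T)" if "u \<in> Field Q" for u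
      using that z(1) by (auto simp: ideal_interior_def ordinal_sum_def)
    moreover have "u \<in> ideal_interior (ordinal_sum P Q) (S \<union> T) \<longleftrightarrow> u \<in> ideal_interior P S"
      if u: "u \<in> Field P" for u
    proof -
      have "(v, u) \<in> ordinal_sum P Q \<longleftrightarrow> (v, u) \<in> P" for v
        using u disj by (auto simp: ordinal_sum_def dest: FieldI1 FieldI2)
      moreover have "v \<in> S \<union> T \<longleftrightarrow> v \<in> S" if "v \<in> Field P" for v using that T disj by blast
      ultimately show ?thesis using u by (auto simp: ideal_interior_def dest: FieldI1)
    qed
    ultimately have "ideal_interior (ordinal_sum P Q) (S \<union> T) = ideal_interior P S"
      by (auto simp: ideal_interior_def)
    then have r: "ideal_rank (ordinal_sum P Q) (S \<union> T) = ideal_rank P S"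
      by (simp add: ideal_rank_eq_card P PQ)
    have le: "ideal_rank P S \<le> card S" using P S by (auto intro: ideal_rank_le)
    have le2: "card S \<le> card (Field P)" using S fin by (auto intro: card_mono)
    have 1: "?p + ?q - ideal_rank P S = ?q + (?p - ideal_rank P S)"
      and 2: "card S + card T - ideal_rank P S = card T + (card S - ideal_rank P S)"
      using le le2 by linarith+
    show ?thesis
      unfolding card r c[OF S(1) T] 1 2 power_add by (simp only: mult_ac)
  qed
  have Y: "(\<Sum>T\<in>Pow (Field Q). ?Y ^ card T) = var_y ^ ?q"
    using sum_Pow_power_card[OF fin(2), of ?Y] by simp
  have "tutte (ordinal_sum P Q) = (\<Sum>S\<in>Pow (Field P). \<Sum>T\<in>Pow (Field Q). ?t (S \<union> T))"
    unfolding tutte_def Field_ordinal_sum sum_Pow_Un[OF disj] ..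
  also have "\<dots> = (\<Sum>T\<in>Pow (Field Q). ?t (Field P \<union> T)) +
      (\<Sum>S\<in>Pow (Field P) - {Field P}. \<Sum>T\<in>Pow (Field Q). ?t (S \<union> T))"
    by (rule sum.remove) (use fin in auto)
  also have "(\<Sum>T\<in>Pow (Field Q). ?t (Field P \<union> T)) = tutte Q"
    unfolding tutte_def by (intro sum.cong refl tm_top) auto
  also have "(\<Sum>S\<in>Pow (Field P) - {Field P}. \<Sum>T\<in>Pow (Field Q). ?t (S \<union> T)) =
      (\<Sum>S\<in>Pow (Field P) - {Field P}. \<Sum>T\<in>Pow (Field Q). ?X ^ ?q * ?Y ^ card T * ?tP S)"
    by (intro sum.cong refl tm) auto
  also have "\<dots> = (\<Sum>S\<in>Pow (Field P) - {Field P}. (?X ^ ?q * var_y ^ ?q) * ?tP S)"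
    unfolding Y[symmetric] by (simp only: sum_distrib_left sum_distrib_right)
  also have "\<dots> = (?X * var_y) ^ ?q * (\<Sum>S\<in>Pow (Field P) - {Field P}. ?tP S)"
    by (simp only: power_mult_distrib sum_distrib_left)
  also have "(\<Sum>S\<in>Pow (Field P) - {Field P}. ?tP S) = tutte P - 1"
  proof -
    have "tutte P = ?tP (Field P) + (\<Sum>S\<in>Pow (Field P) - {Field P}. ?tP S)"
      unfolding tutte_def by (rule sum.remove) (use fin in auto)
    then show ?thesis by (simp add: rP)
  qed
  finally show ?thesis by (simp add: add.commute)
qed

section \<open>Decompositions and induced subposets of series-parallel posets\<close>

lemma poset_iso_map_prod:
  assumes "inj_on f (Field P)"
  shows "poset_iso P (map_prod f f ` P)" "Field (map_prod f f ` P) = f ` Field P"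
proof -
  show F: "Field (map_prod f f ` P) = f ` Field P"
    by (force simp: Field_def)
  have "(a, b) \<in> P \<longleftrightarrow> (f a, f b) \<in> map_prod f f ` P" if "a \<in> Field P" "b \<in> Field P" for a b
  proof
    assume "(f a, f b) \<in> map_prod f f ` P"
    then obtain c d where cd: "(c, d) \<in> P" "f a = f c" "f b = f d" by auto
    then have "a = c" "b = d"
      using that assms by (auto dest: inj_onD FieldI1 FieldI2)
    then show "(a, b) \<in> P" using cd by simp
  qed force
  then show "poset_iso P (map_prod f f ` P)"
    unfolding poset_iso_def F using assms by (auto simp: bij_betw_def)
qed

text \<open>Writing the isomorphic copy as an image lets decompositions be carried over, since
  images commute with unions of relations.\<close>

lemma poset_isoE:
  assumes "poset_iso P Q"
  obtains f where "inj_on f (Field P)" "Q = map_prod f f ` P"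
proof -
  obtain f where f: "bij_betw f (Field P) (Field Q)"
    and rel: "\<And>a b. a \<in> Field P \<Longrightarrow> b \<in> Field P \<Longrightarrow> (a, b) \<in> P \<longleftrightarrow> (f a, f b) \<in> Q"
    using assms unfolding poset_iso_def by blast
  have im: "f ` Field P = Field Q" using f by (simp add: bij_betw_def)
  have "(u, v) \<in> map_prod f f ` P" if "(u, v) \<in> Q" for u v
  proof -
    have "u \<in> f ` Field P" "v \<in> f ` Field P" using that im by (auto intro: FieldI1 FieldI2)
    then obtain a b where "a \<in> Field P" "b \<in> Field P" "u = f a" "v = f b" by blast
    then show ?thesis using that rel by force
  qed
  moreover have "map_prod f f ` P \<subseteq> Q"
    using rel by (auto dest: FieldI1 FieldI2)
  ultimately have "Q = map_prod f f ` P" by auto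
  moreover have "inj_on f (Field P)" using f by (simp add: bij_betw_def)
  ultimately show thesis by (rule that[rotated])
qed

text \<open>The rule \<open>iso\<close> of \<open>SP\<close> is eliminated by transporting the
  decomposition of the original to the copy. The decompositions are therefore equalities, not just
  isomorphisms.\<close>

lemma SP_cases [consumes 1, case_names one direct ordinal]:
  assumes "P \<in> SP"
  obtains x where "P = {(x, x)}"
  | A B where "A \<in> SP" "B \<in> SP" "Field A \<inter> Field B = {}" "P = direct_sum A B"
  | A B where "A \<in> SP" "B \<in> SP" "Field A \<inter> Field B = {}" "P = ordinal_sum A B"
proof -
  have "(\<exists>x. P = {(x, x)}) \<or>
    (\<exists>A B. A \<in> SP \<and> B \<in> SP \<and> Field A \<inter> Field B = {} \<and> (P = direct_sum A B \<or> P = ordinal_sum A B))"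
    using assms
  proof induction
    case (iso P Q)
    obtain f where f: "inj_on f (Field P)" and Q: "Q = map_prod f f ` P"
      using iso.hyps(2) by (rule poset_isoE)
    let ?m = "\<lambda>R. map_prod f f ` R"
    from iso.IH show ?case
    proof (elim disjE exE conjE)
      fix x assume "P = {(x, x)}"
      then show ?thesis using Q by auto
    next
      fix A B assume AB: "A \<in> SP" "B \<in> SP" "Field A \<inter> Field B = {}" "P = direct_sum A B"
      have inj: "inj_on f (Field A)" "inj_on f (Field B)"
        using f AB(4) by (auto intro: inj_on_subset)
      have "?m A \<in> SP" "?m B \<in> SP"
        using AB(1,2) inj by (auto intro: SP.iso poset_iso_map_prod)
      moreover have "Field (?m A) \<inter> Field (?m B) = {}"
        using AB(3,4) f inj by (auto simp: poset_iso_map_prod inj_on_def)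
      moreover have "Q = direct_sum (?m A) (?m B)"
        using Q AB(4) by (simp add: direct_sum_def image_Un)
      ultimately show ?thesis by blast
    next
      fix A B assume AB: "A \<in> SP" "B \<in> SP" "Field A \<inter> Field B = {}" "P = ordinal_sum A B"
      have inj: "inj_on f (Field A)" "inj_on f (Field B)"
        using f AB(4) by (auto intro: inj_on_subset)
      have "?m A \<in> SP" "?m B \<in> SP"
        using AB(1,2) inj by (auto intro: SP.iso poset_iso_map_prod)
      moreover have "Field (?m A) \<inter> Field (?m B) = {}"
        using AB(3,4) f inj by (auto simp: poset_iso_map_prod inj_on_def)
      moreover have "Q = ordinal_sum (?m A) (?m B)"
        using Q AB(4) inj by (force simp: ordinal_sum_def poset_iso_map_prod)
      ultimately show ?thesis by blast
    qed
  qed blast+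
  then show thesis using that by blast
qed

lemma Field_Restr_poset: "finite_poset P \<Longrightarrow> Field (Restr P W) = Field P \<inter> W"
  by (auto simp: Field_def dest: finite_poset_refl intro: FieldI1 FieldI2)

text \<open>Restriction distributes over both sums. If one part misses \<open>W\<close>, its
  restriction is empty and the sum collapses to the restriction of the other part.\<close>

lemma SP_Restr:
  assumes "P \<in> SP" "Field P \<inter> W \<noteq> {}"
  shows "Restr P W \<in> SP"
  using assms
proof (induction arbitrary: W)
  case (one x)
  then have "Restr {(x, x)} W = {(x, x)}" by (auto simp: Field_def)
  then show ?case by (simp add: SP.one)
next
  case (direct P Q)
  have fp: "finite_poset P" "finite_poset Q" using direct by (auto dest: SP_finite_poset)
  have eq: "Restr (direct_sum P Q) W = direct_sum (Restr P W) (Restr Q W)"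
    by (auto simp: direct_sum_def)
  have e: "Restr R W = {}" if "Field R \<inter> W = {}" for R :: "'a rel"
    using that by (auto intro: FieldI1)
  consider "Field P \<inter> W = {}" | "Field Q \<inter> W = {}" | "Field P \<inter> W \<noteq> {}" "Field Q \<inter> W \<noteq> {}"
    by blast
  then show ?case
  proof cases
    case 1
    then have "Field Q \<inter> W \<noteq> {}" using direct.prems by auto
    then show ?thesis unfolding eq e[OF 1] using direct.IH by (simp add: direct_sum_def)
  next
    case 2
    then have "Field P \<inter> W \<noteq> {}" using direct.prems by auto
    then show ?thesis unfolding eq e[OF 2] using direct.IH by (simp add: direct_sum_def)
  next
    case 3
    then show ?thesis unfolding eq
      by (intro SP.direct direct.IH) (use direct.hyps fp in \<open>auto simp: Field_Restr_poset\<close>)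
  qed
next
  case (ordinal P Q)
  have fp: "finite_poset P" "finite_poset Q" using ordinal by (auto dest: SP_finite_poset)
  have eq: "Restr (ordinal_sum P Q) W = ordinal_sum (Restr P W) (Restr Q W)"
    by (auto simp: ordinal_sum_def Field_Restr_poset fp)
  have e: "Restr R W = {}" if "Field R \<inter> W = {}" for R :: "'a rel"
    using that by (auto intro: FieldI1)
  consider "Field P \<inter> W = {}" | "Field Q \<inter> W = {}" | "Field P \<inter> W \<noteq> {}" "Field Q \<inter> W \<noteq> {}"
    by blast
  then show ?case
  proof cases
    case 1
    then have "Field Q \<inter> W \<noteq> {}" using ordinal.prems by auto
    then show ?thesis unfolding eq e[OF 1] using ordinal.IH by (simp add: ordinal_sum_def)
  next
    case 2
    then have "Field P \<inter> W \<noteq> {}" using ordinal.prems by auto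
    then show ?thesis unfolding eq e[OF 2] using ordinal.IH by (simp add: ordinal_sum_def)
  next
    case 3
    then show ?thesis unfolding eq
      by (intro SP.ordinal ordinal.IH) (use ordinal.hyps fp in \<open>auto simp: Field_Restr_poset\<close>)
  qed
next
  case (iso P Q)
  obtain f where f: "inj_on f (Field P)" and Q: "Q = map_prod f f ` P"
    using iso.hyps(2) by (rule poset_isoE)
  \<comment> \<open>Restricting the copy to \<open>W\<close> is the image of restricting the
    original to the preimage of \<open>W\<close>.\<close>
  let ?V = "{a. f a \<in> W}"
  have "Field P \<inter> ?V \<noteq> {}"
    using iso.prems f Q by (auto simp: poset_iso_map_prod)
  then have "Restr P ?V \<in> SP" by (rule iso.IH)
  moreover have "inj_on f (Field (Restr P ?V))"
    using f by (rule inj_on_subset) (auto intro: mono_Field[THEN subsetD])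
  ultimately have "map_prod f f ` Restr P ?V \<in> SP"
    by (blast intro: SP.iso poset_iso_map_prod)
  moreover have "map_prod f f ` Restr P ?V = Restr Q W"
    unfolding Q by force
  ultimately show ?case by simp
qed

lemma tutte_singleton: "tutte {(x, x)} = var_x"
proof -
  let ?P = "{(x, x)}"
  have fp: "finite_poset ?P" using SP_finite_poset[OF SP.one[of x]] by blast
  have F: "Field ?P = {x}" by (auto simp: Field_def)
  have "ideal_interior ?P {} = {}" "ideal_interior ?P {x} = {x}"
    by (auto simp: ideal_interior_def F)
  then have "ideal_rank ?P {} = 0" "ideal_rank ?P {x} = 1"
    by (simp_all add: ideal_rank_eq_card[OF fp])
  then show ?thesis unfolding tutte_def F by (simp add: Pow_insert one_pCons)
qed

subsection \<open>Counting filters\<close>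

text \<open>At \<open>y = 1\<close> only the order ideals \<open>S\<close> contribute to the Tutte polynomial,
  so the coefficient of \<open>x ^ k\<close> below is the number of filters with \<open>k\<close> elements.\<close>

definition filter_poly :: "'a rel \<Rightarrow> rat poly" where
  "filter_poly P = pcompose (poly (tutte P) 1) [:1, 1:]"

lemma filter_poly_direct_sum:
  assumes "P \<in> SP" "Q \<in> SP" "Field P \<inter> Field Q = {}"
  shows "filter_poly (direct_sum P Q) = filter_poly P * filter_poly Q"
  using assms by (simp add: filter_poly_def tutte_direct_sum SP_finite_poset pcompose_mult)

text \<open>Setting \<open>y = 1\<close> and replacing \<open>x\<close> by \<open>x + 1\<close>
  turns \<open>(x - 1) y\<close> into \<open>x\<close>, so the power in
  \<open>tutte_ordinal_sum\<close> becomes a shift of coefficients.\<close>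

lemma filter_poly_ordinal_sum:
  assumes "P \<in> SP" "Q \<in> SP" "Field P \<inter> Field Q = {}"
  shows "filter_poly (ordinal_sum P Q) =
    monom 1 (card (Field Q)) * (filter_poly P - 1) + filter_poly Q"
proof -
  have "[:-1, 1:] ^ n \<circ>\<^sub>p [:1, 1:] = monom (1::rat) n" for n
  proof (induction n)
    case (Suc n)
    have "[:-1, 1:] \<circ>\<^sub>p [:1, 1:] = [:0, 1::rat:]" by (simp add: pcompose_pCons)
    then show ?case unfolding power_Suc pcompose_mult Suc by (simp add: monom_Suc)
  qed (simp add: pcompose_1)
  moreover have "poly (var_x - 1) 1 = [:-1, 1:]" by (simp add: one_pCons)
  moreover have "poly (tutte P - 1) 1 = poly (tutte P) 1 - 1" by simp
  ultimately show ?thesis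
    using assms
    by (simp add: filter_poly_def tutte_ordinal_sum SP_finite_poset poly_power power_mult_distrib
        pcompose_add pcompose_mult pcompose_diff pcompose_1 del: diff_pCons poly_diff)
qed

text \<open>All terms of the convolution are nonnegative, so it is bounded below by any subfamily of
  its terms. One admissible splitting of \<open>k\<close> gives the first bound, two neighbouring
  ones the second.\<close>

lemma
  fixes A B :: "rat poly"
  assumes A: "\<And>i. i \<le> a \<Longrightarrow> 1 \<le> coeff A i" "\<And>i. a < i \<Longrightarrow> coeff A i = 0"
    and B: "\<And>i. i \<le> b \<Longrightarrow> 1 \<le> coeff B i" "\<And>i. b < i \<Longrightarrow> coeff B i = 0"
  shows coeff_mult_ge_1: "k \<le> a + b \<Longrightarrow> 1 \<le> coeff (A * B) k"
    and coeff_mult_ge_2: "0 < k \<Longrightarrow> k < a + b \<Longrightarrow> 0 < a \<Longrightarrow> 0 < b \<Longrightarrow> 2 \<le> coeff (A * B) k"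
proof -
  have nonneg: "0 \<le> coeff A i * coeff B j" for i j
    using A[of i] B[of j] by (cases "i \<le> a"; cases "j \<le> b") auto
  have ge: "1 \<le> coeff A i * coeff B j" if "i \<le> a" "j \<le> b" for i j
    using mult_mono[OF A(1)[OF that(1)] B(1)[OF that(2)]] A(1)[OF that(1)] by simp
  have mono: "(\<Sum>i\<in>I. coeff A i * coeff B (k - i)) \<le> coeff (A * B) k" if "I \<subseteq> {..k}" for I
    unfolding coeff_mult by (rule sum_mono2) (use that nonneg in auto)
  {
    assume "k \<le> a + b"
    then have "k - min k a \<le> b" by linarith
    then show "1 \<le> coeff (A * B) k"
      using mono[of "{min k a}"] ge[of "min k a" "k - min k a"] by simp
  next
    assume k: "0 < k" "k < a + b" "0 < a" "0 < b"
    \<comment> \<open>The largest index admissible for \<open>A\<close>. Since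
      \<open>k < a + b\<close> and all of \<open>k\<close>, \<open>a\<close>, \<open>b\<close> are
      positive, \<open>?i - 1\<close> is a different index and its cofactor
      \<open>k - (?i - 1)\<close> is still at most \<open>b\<close>.\<close>
    let ?i = "min k a"
    have "coeff A ?i * coeff B (k - ?i) + coeff A (?i - 1) * coeff B (k - (?i - 1)) \<le> coeff (A * B) k"
      using mono[of "{?i, ?i - 1}"] k by auto
    moreover have "1 \<le> coeff A ?i * coeff B (k - ?i)" "1 \<le> coeff A (?i - 1) * coeff B (k - (?i - 1))"
      using k by (auto intro!: ge)
    ultimately show "2 \<le> coeff (A * B) k" by linarith
  }
qed

lemma degree_eqI: "coeff p n \<noteq> 0 \<Longrightarrow> \<forall>i>n. coeff p i = 0 \<Longrightarrow> degree p = n"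
  by (intro antisym degree_le le_degree)

lemma card_Field_pos: "P \<in> SP \<Longrightarrow> 0 < card (Field P)"
  using SP_finite_poset by (auto simp: finite_poset_def card_gt_0_iff)

lemma card_Field_Un:
  assumes "P \<in> SP" "Q \<in> SP" "Field P \<inter> Field Q = {}"
  shows "card (Field P \<union> Field Q) = card (Field P) + card (Field Q)"
  using assms SP_finite_poset by (intro card_Un_disjoint) (auto simp: finite_poset_def)

text \<open>Only the empty set and the whole poset are filters of extreme size, and every size in
  between occurs. The exact values at both ends are carried through the induction because in an
  ordinal sum the two coefficient sequences overlap there.\<close>

lemma coeff_filter_poly:
  assumes "P \<in> SP"
  shows "coeff (filter_poly P) 0 = 1 \<and> coeff (filter_poly P) (card (Field P)) = 1 \<and>
    (\<forall>i\<le>card (Field P). 1 \<le> coeff (filter_poly P) i) \<and>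
    (\<forall>i>card (Field P). coeff (filter_poly P) i = 0)"
  using assms
proof induction
  case (one x)
  have "card (Field {(x, x)}) = 1" by (simp add: Field_def)
  moreover have "filter_poly {(x, x)} = [:1, 1:]"
    by (simp add: filter_poly_def tutte_singleton pcompose_pCons)
  ultimately show ?case by (auto simp: coeff_pCons split: nat.split)
next
  case (direct P Q)
  let ?p = "card (Field P)" and ?q = "card (Field Q)"
  note eq = filter_poly_direct_sum[OF direct.hyps]
  have deg: "degree (filter_poly P) = ?p" "degree (filter_poly Q) = ?q"
    using direct.IH by (simp_all add: degree_eqI)
  have "coeff (filter_poly P * filter_poly Q) (?p + ?q) = 1"
    using coeff_mult_degree_sum[of "filter_poly P" "filter_poly Q"] direct.IH deg by simp
  moreover have "coeff (filter_poly P * filter_poly Q) i = 0" if "?p + ?q < i" for i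
    using that degree_mult_le[of "filter_poly P" "filter_poly Q"] deg by (simp add: coeff_eq_0)
  moreover have "1 \<le> coeff (filter_poly P * filter_poly Q) i" if "i \<le> ?p + ?q" for i
    using direct.IH that by (intro coeff_mult_ge_1[of ?p _ ?q]) auto
  ultimately show ?case
    using direct.IH unfolding Field_direct_sum card_Field_Un[OF direct.hyps] eq
    by (auto simp: coeff_mult_0)
next
  case (ordinal P Q)
  show ?case
    using ordinal.IH card_Field_pos[OF ordinal.hyps(1)] card_Field_pos[OF ordinal.hyps(2)]
    unfolding Field_ordinal_sum card_Field_Un[OF ordinal.hyps] filter_poly_ordinal_sum[OF ordinal.hyps]
    by (auto simp: coeff_monom_mult not_less)
next
  case (iso P Q)
  have P: "finite_poset P" using iso by (simp add: SP_finite_poset)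
  have "filter_poly P = filter_poly Q" using P iso by (simp add: filter_poly_def tutte_iso)
  moreover have "card (Field P) = card (Field Q)" using P iso by (simp add: poset_iso_card)
  ultimately show ?case using iso.IH by simp
qed

text \<open>A filter of the sum that meets \<open>P\<close> contains all of \<open>Q\<close>. So up
  to size \<open>card (Field Q)\<close> only filters of \<open>Q\<close> are counted, and beyond it
  those of \<open>P\<close>, shifted.\<close>

lemma coeff_filter_poly_ordinal_sum:
  assumes "P \<in> SP" "Q \<in> SP" "Field P \<inter> Field Q = {}"
  shows "coeff (filter_poly (ordinal_sum P Q)) k =
    (if k \<le> card (Field Q) then coeff (filter_poly Q) k else coeff (filter_poly P) (k - card (Field Q)))"
  using coeff_filter_poly[OF assms(1)] coeff_filter_poly[OF assms(2)]
  unfolding filter_poly_ordinal_sum[OF assms] by (auto simp: coeff_monom_mult)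

lemma coeff_filter_poly_direct_sum:
  assumes "P \<in> SP" "Q \<in> SP" "Field P \<inter> Field Q = {}" "0 < k" "k < card (Field P) + card (Field Q)"
  shows "2 \<le> coeff (filter_poly (direct_sum P Q)) k"
  unfolding filter_poly_direct_sum[OF assms(1-3)]
  using assms coeff_filter_poly[OF assms(1)] coeff_filter_poly[OF assms(2)] card_Field_pos
  by (intro coeff_mult_ge_2[of "card (Field P)" _ "card (Field Q)"]) auto

text \<open>The largest filter is the whole poset, so the degree of the filter polynomial is the
  size of the poset.\<close>

lemma card_Field_eqI:
  assumes "P \<in> SP" "Q \<in> SP" "tutte P = tutte Q"
  shows "card (Field P) = card (Field Q)"
proof -
  have eq: "filter_poly P = filter_poly Q" using assms by (simp add: filter_poly_def)
  have "degree (filter_poly P) = card (Field P)" "degree (filter_poly Q) = card (Field Q)"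
    using coeff_filter_poly[OF assms(1)] coeff_filter_poly[OF assms(2)]
    by (simp_all add: degree_eqI)
  then show ?thesis using eq by simp
qed

lemma ordinal_sum_assoc: "ordinal_sum (ordinal_sum A B) C = ordinal_sum A (ordinal_sum B C)"
  by (simp add: ordinal_sum_def[of "ordinal_sum A B"] ordinal_sum_def[of A "ordinal_sum B C"])
    (auto simp: ordinal_sum_def)

text \<open>A unique filter of size \<open>k\<close> marks a cut of the ordinal decomposition,
  because a direct sum has at least two filters of every intermediate size.\<close>

lemma ordinal_sum_split:
  assumes "Q \<in> SP" "coeff (filter_poly Q) k = 1" "0 < k" "k < card (Field Q)"
  shows "\<exists>A B. A \<in> SP \<and> B \<in> SP \<and> Field A \<inter> Field B = {} \<and> Q = ordinal_sum A B \<and> card (Field B) = k"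
  using assms
proof (induction "card (Field Q)" arbitrary: Q k rule: less_induct)
  case less
  from less.prems(1) show ?case
  proof (cases rule: SP_cases)
    case (one x)
    then show ?thesis using less.prems by (simp add: Field_def)
  next
    case (direct A B)
    then show ?thesis
      using coeff_filter_poly_direct_sum[OF direct(1-3) less.prems(3)] less.prems card_Field_Un[OF direct(1-3)]
      by simp
  next
    case (ordinal A B)
    have card: "card (Field Q) = card (Field A) + card (Field B)"
      using card_Field_Un[OF ordinal(1-3)] ordinal(4) by simp
    have pos: "0 < card (Field A)" "0 < card (Field B)" using ordinal by (auto intro: card_Field_pos)
    note co = coeff_filter_poly_ordinal_sum[OF ordinal(1-3), of k]
    consider "k = card (Field B)" | "k < card (Field B)" | "k > card (Field B)" by linarith
    then show ?thesis
    proof cases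
      case 1
      then show ?thesis using ordinal by blast
    next
      case 2
      \<comment> \<open>The cut lies inside the upper part \<open>B\<close>; rebracketing moves it
        to the top level.\<close>
      then obtain C D where CD: "C \<in> SP" "D \<in> SP" "Field C \<inter> Field D = {}" "B = ordinal_sum C D" "card (Field D) = k"
        using less.hyps[of B k] card pos ordinal co less.prems by auto
      have "ordinal_sum A C \<in> SP" using ordinal CD by (intro SP.ordinal) auto
      moreover have "Q = ordinal_sum (ordinal_sum A C) D"
        using ordinal CD by (simp add: ordinal_sum_assoc)
      ultimately show ?thesis using CD ordinal by (intro exI[of _ "ordinal_sum A C"] exI[of _ D]) auto
    next
      case 3
      \<comment> \<open>The cut lies inside the lower part \<open>A\<close>, where it has to be
        sought at size \<open>k - card (Field B)\<close>.\<close>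
      then obtain C D where CD: "C \<in> SP" "D \<in> SP" "Field C \<inter> Field D = {}" "A = ordinal_sum C D"
         "card (Field D) = k - card (Field B)"
        using less.hyps[of A "k - card (Field B)"] card pos ordinal co less.prems
          less_diff_conv2[of "card (Field B)" k "card (Field A)"] by auto
      have DB: "ordinal_sum D B \<in> SP" "Field D \<inter> Field B = {}" using ordinal CD by (auto intro!: SP.ordinal)
      moreover have "Q = ordinal_sum C (ordinal_sum D B)"
        using ordinal CD by (simp add: ordinal_sum_assoc)
      moreover have "card (Field (ordinal_sum D B)) = k"
        using card_Field_Un[of D B] DB CD ordinal 3 by simp
      ultimately show ?thesis using CD ordinal by (intro exI[of _ C] exI[of _ "ordinal_sum D B"]) auto
    qed
  qed
qed

subsection \<open>Separating the parts of an ordinal sum\<close>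

text \<open>At \<open>x = 1\<close> only \<open>S = Field P\<close> contributes, with value 1. The
  induction derives this from the two sum formulas.\<close>

lemma tutte_minus_1_dvd: "P \<in> SP \<Longrightarrow> var_x - 1 dvd tutte P - 1"
proof (induction rule: SP.induct)
  case (one x)
  then show ?case by (simp add: tutte_singleton)
next
  case (direct P Q)
  have "tutte (direct_sum P Q) - 1 = (tutte P - 1) * tutte Q + (tutte Q - 1)"
    using direct.hyps by (simp add: tutte_direct_sum SP_finite_poset left_diff_distrib)
  then show ?case using direct.IH by (metis dvd_add dvd_mult2)
next
  case (ordinal P Q)
  have "tutte (ordinal_sum P Q) - 1 = ((var_x - 1) * var_y) ^ card (Field Q) * (tutte P - 1) + (tutte Q - 1)"
    using ordinal.hyps by (simp add: tutte_ordinal_sum SP_finite_poset)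
  then show ?case using ordinal.IH by (metis dvd_add dvd_mult)
next
  case (iso P Q)
  then show ?case by (metis tutte_iso SP_finite_poset)
qed

text \<open>Coefficients are taken with respect to \<open>y\<close> and are polynomials in
  \<open>x\<close>, so this bounds the \<open>x\<close>-degree of a product.\<close>

lemma degree_coeff_mult_le:
  fixes p q :: "'b::comm_semiring_1 poly poly"
  assumes "\<And>i. degree (coeff p i) \<le> m" "\<And>i. degree (coeff q i) \<le> n"
  shows "degree (coeff (p * q) i) \<le> m + n"
  unfolding coeff_mult
proof (rule degree_sum_le)
  fix j assume "j \<in> {..i}"
  show "degree (coeff p j * coeff q (i - j)) \<le> m + n"
    using degree_mult_le[of "coeff p j" "coeff q (i - j)"] assms(1)[of j] assms(2)[of "i - j"] by linarith
qed simp

lemma degree_coeff_tutte: "P \<in> SP \<Longrightarrow> degree (coeff (tutte P) i) \<le> card (Field P)"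
proof (induction arbitrary: i rule: SP.induct)
  case (one x)
  then show ?case by (simp add: tutte_singleton Field_def coeff_pCons split: nat.split)
next
  case (direct P Q)
  have "tutte (direct_sum P Q) = tutte P * tutte Q"
    using direct.hyps by (simp add: tutte_direct_sum SP_finite_poset)
  then show ?case
    using card_Field_Un[OF direct.hyps] degree_coeff_mult_le[OF direct.IH] by simp
next
  case (ordinal P Q)
  have *: "degree (coeff ((var_x - 1) * var_y) i) \<le> 1" for i
    by (simp add: one_pCons coeff_pCons split: nat.split)
  have pow: "degree (coeff (((var_x - 1) * var_y) ^ n) i) \<le> n" for n i
  proof (induction n arbitrary: i)
    case (Suc n)
    show ?case using degree_coeff_mult_le[OF * Suc] by simp
  qed (simp add: coeff_1)
  have 1: "degree (coeff (tutte P - 1) i) \<le> card (Field P)" for i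
    using ordinal.IH(1)[of i] by (auto intro!: degree_diff_le simp: coeff_1)
  have "tutte (ordinal_sum P Q) = ((var_x - 1) * var_y) ^ card (Field Q) * (tutte P - 1) + tutte Q"
    using ordinal.hyps by (simp add: tutte_ordinal_sum SP_finite_poset)
  moreover have "degree (coeff (((var_x - 1) * var_y) ^ card (Field Q) * (tutte P - 1)) i)
      \<le> card (Field P) + card (Field Q)"
    using degree_coeff_mult_le[OF pow 1, of "card (Field Q)"] by (simp only: add.commute)
  moreover have "degree (coeff (tutte Q) i) \<le> card (Field P) + card (Field Q)"
    using ordinal.IH(2) by (rule trans_le_add2)
  ultimately show ?case
    unfolding Field_ordinal_sum card_Field_Un[OF ordinal.hyps] by (simp only: coeff_add degree_add_le)
next
  case (iso P Q)
  then show ?case by (metis tutte_iso SP_finite_poset poset_iso_card)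
qed

text \<open>The two summands in the formula for \<open>tutte (ordinal_sum A B)\<close> are separated by their
  \<open>(x - 1)\<close>-adic size: the first is divisible by \<open>(x - 1) ^ (card (Field B) + 1)\<close>, and the
  second has \<open>x\<close>-degree at most \<open>card (Field B)\<close>.\<close>

lemma tutte_ordinal_sum_cancel:
  assumes SP: "A \<in> SP" "B \<in> SP" "C \<in> SP" "D \<in> SP"
    and disj: "Field A \<inter> Field B = {}" "Field C \<inter> Field D = {}"
    and card: "card (Field B) = card (Field D)"
    and eq: "tutte (ordinal_sum A B) = tutte (ordinal_sum C D)"
  shows "tutte A = tutte C" "tutte B = tutte D"
proof -
  let ?q = "card (Field D)"
  let ?X = "[:[:-1, 1:]:] :: rat poly poly"
  have X: "var_x - 1 = ?X" by (simp add: one_pCons)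
  have fp: "finite_poset A" "finite_poset B" "finite_poset C" "finite_poset D"
    using SP by (auto dest: SP_finite_poset)
  have "(?X * var_y) ^ ?q * (tutte A - 1) + tutte B = (?X * var_y) ^ ?q * (tutte C - 1) + tutte D"
    using eq unfolding tutte_ordinal_sum[OF fp(1,2) disj(1)] tutte_ordinal_sum[OF fp(3,4) disj(2)] card X .
  then have e: "tutte B - tutte D = (?X * var_y) ^ ?q * (tutte C - tutte A)"
    by (simp add: algebra_simps)
  have "?X dvd (tutte C - 1) - (tutte A - 1)"
    using tutte_minus_1_dvd[OF SP(1)] tutte_minus_1_dvd[OF SP(3)] unfolding X by (rule dvd_diff[rotated])
  then have "?X ^ ?q * ?X dvd ?X ^ ?q * (tutte C - tutte A)"
    by (intro mult_dvd_mono) simp_all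
  then have "?X ^ ?q * ?X dvd var_y ^ ?q * (?X ^ ?q * (tutte C - tutte A))"
    by (rule dvd_mult)
  then have "?X ^ Suc ?q dvd tutte B - tutte D"
    unfolding e by (simp only: power_mult_distrib power_Suc mult_ac)
  moreover have "?X ^ Suc ?q = [:[:-1, 1:] ^ Suc ?q:]" by (simp add: poly_const_pow)
  \<comment> \<open>A divisor that is constant in \<open>y\<close> divides every coefficient. These
    have \<open>x\<close>-degree at most \<open>?q\<close>, below the degree \<open>?q + 1\<close>
    of the divisor, so they vanish.\<close>
  ultimately have "[:-1, 1:] ^ Suc ?q dvd coeff (tutte B - tutte D) i" for i
    by (metis const_poly_dvd_iff)
  moreover have "degree (coeff (tutte B - tutte D) i) < degree ([:-1, 1::rat:] ^ Suc ?q)" for i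
  proof -
    have "degree (coeff (tutte B - tutte D) i) \<le> ?q"
      using degree_coeff_tutte[OF SP(2), of i] degree_coeff_tutte[OF SP(4), of i] card
      by (auto intro: degree_diff_le)
    then show ?thesis by (simp add: degree_power_eq del: power_Suc)
  qed
  ultimately have "coeff (tutte B - tutte D) i = 0" for i
    by (meson dvd_imp_degree_le leD)
  then show BD: "tutte B = tutte D" by (metis coeff_0 eq_iff_diff_eq_0 poly_eqI)
  then show "tutte A = tutte C" using e by simp
qed

subsection \<open>Factorization\<close>

text \<open>Each prime factor divides \<open>a\<close> or \<open>b\<close>; it is assigned to that
  side and cancelled. The units \<open>u\<close> and \<open>v\<close> are what is left of
  \<open>a\<close> and \<open>b\<close> at the end.\<close>

lemma prod_prime_eq_mult:
  fixes f :: "'b \<Rightarrow> 'a::{idom, algebraic_semidom}"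
  assumes "finite D" "\<And>c. c \<in> D \<Longrightarrow> prime_elem (f c)" "prod f D = a * b"
  shows "\<exists>J\<subseteq>D. \<exists>u v. u * v = 1 \<and> a = u * prod f J \<and> b = v * prod f (D - J)"
  using assms
proof (induction D arbitrary: a b)
  case empty
  then show ?case by auto
next
  case (insert c D)
  have pr: "prime_elem (f c)" using insert.prems by simp
  have nz: "f c \<noteq> 0" using pr by auto
  have e: "f c * prod f D = a * b" using insert by simp
  then have "f c dvd a * b" by (metis dvd_triv_left)
  then have "f c dvd a \<or> f c dvd b" using pr by (simp add: prime_elem_dvd_mult_iff)
  then consider a' where "a = f c * a'" | b' where "b = f c * b'"
    by (metis dvdE)
  then show ?case
  proof cases
    case 1
    then have "prod f D = a' * b" using e nz by (simp add: mult.assoc)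
    then obtain J u v where J: "J \<subseteq> D" "u * v = 1" "a' = u * prod f J" "b = v * prod f (D - J)"
      using insert by (metis insertCI)
    have "finite J" "c \<notin> J" using J insert finite_subset by auto
    moreover have "insert c D - insert c J = D - J" using insert J by auto
    ultimately show ?thesis using J 1
      by (intro exI[of _ "insert c J"] conjI exI[of _ u] exI[of _ v]) (auto simp: mult_ac)
  next
    case 2
    then have "prod f D = a * b'" using e nz by (simp add: mult.left_commute)
    then obtain J u v where J: "J \<subseteq> D" "u * v = 1" "a = u * prod f J" "b' = v * prod f (D - J)"
      using insert by (metis insertCI)
    have "finite (D - J)" "c \<notin> D - J" using J insert by auto
    moreover have "insert c D - J = insert c (D - J)" using insert J by auto
    ultimately show ?thesis using J 2
      by (intro exI[of _ J] conjI exI[of _ u] exI[of _ v]) (auto simp: mult_ac)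
  qed
qed

text \<open>Units of the polynomial ring are constants. Both \<open>a\<close> and \<open>b\<close>
  are 1 modulo \<open>x - 1\<close>, hence so is \<open>u\<close>, and a constant that is 1 modulo
  \<open>x - 1\<close> equals 1.\<close>

lemma tutte_eq_of_associated:
  assumes "var_x - 1 dvd a - 1" "var_x - 1 dvd b - 1" "a = u * b" "u dvd 1"
  shows "a = b"
proof -
  obtain c where "u = [:[:c:]:]"
    using assms(4) by (auto simp: is_unit_poly_iff)
  have "var_x - 1 dvd (a - 1) - u * (b - 1)"
    by (rule dvd_diff[OF assms(1) dvd_mult[OF assms(2)]])
  then have "var_x - 1 dvd u - 1" by (simp add: assms(3) right_diff_distrib)
  then have "[:[:-1, 1:]:] dvd [:[:c - 1:]:]" by (simp add: \<open>u = _\<close> one_pCons)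
  then have "[:-1, 1:] dvd [:c - 1:]" by (simp only: const_poly_dvd_const_poly_iff)
  then have "c = 1" using dvd_imp_degree_le[of "[:-1, 1:]" "[:c - 1:]"] by auto
  then show ?thesis using assms(3) \<open>u = _\<close> by (simp flip: one_pCons)
qed

subsection \<open>Series-parallel posets with irreducible direct summands\<close>

text \<open>Direct sums are taken over all components at once: a subset of the components again
  satisfies the irreducibility condition, whereas a partial binary sum is reducible.\<close>

inductive_set SP_irr :: "'a rel set" where
  one: "{(x, x)} \<in> SP_irr"
| ordinal: "A \<in> SP_irr \<Longrightarrow> B \<in> SP_irr \<Longrightarrow> Field A \<inter> Field B = {} \<Longrightarrow> ordinal_sum A B \<in> SP_irr"
| direct: "2 \<le> card D \<Longrightarrow> \<forall>C\<in>D. C \<in> SP_irr \<Longrightarrow>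
    \<forall>C\<in>D. irreducible (tutte C) \<Longrightarrow> disjoint_family_on Field D \<Longrightarrow> \<Union>D \<in> SP_irr"

lemma SP_Union:
  assumes "finite D" "D \<noteq> {}" "D \<subseteq> SP" "disjoint_family_on Field D"
  shows "\<Union>D \<in> SP \<and> tutte (\<Union>D) = prod tutte D"
  using assms
proof (induction D rule: finite_ne_induct)
  case (insert C D)
  have IH: "\<Union>D \<in> SP" "tutte (\<Union>D) = prod tutte D" and C: "C \<in> SP"
    using insert by (auto simp: disjoint_family_on_def)
  have disj: "Field C \<inter> Field (\<Union>D) = {}"
    using insert.prems insert.hyps(3) by (auto simp: disjoint_family_on_def Field_Union)
  have eq: "\<Union>(insert C D) = direct_sum C (\<Union>D)"
    by (simp add: direct_sum_def)
  have "tutte (direct_sum C (\<Union>D)) = tutte C * tutte (\<Union>D)"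
    using C IH(1) disj by (intro tutte_direct_sum) (simp_all add: SP_finite_poset)
  then show ?case
    using SP.direct[OF C IH(1) disj] IH(2) insert.hyps unfolding eq by simp
qed simp

lemma SP_irr_SP: "P \<in> SP_irr \<Longrightarrow> P \<in> SP"
proof (induction rule: SP_irr.induct)
  case (direct D)
  then have "finite D" "D \<noteq> {}" by (auto intro: card_ge_0_finite)
  then show ?case using direct SP_Union by blast
qed (auto intro: SP.intros)

text \<open>Extends the rule \<open>direct\<close> to a family with a single member, whose union is
  that member.\<close>

lemma SP_irr_Union:
  assumes "finite D" "D \<noteq> {}" "D \<subseteq> SP_irr" "disjoint_family_on Field D"
    and "\<And>C. C \<in> D \<Longrightarrow> irreducible (tutte C)"
  shows "\<Union>D \<in> SP_irr"
proof (cases "2 \<le> card D")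
  case True
  then show ?thesis using assms by (auto intro: SP_irr.direct)
next
  case False
  then have "card D = 1" using assms(1,2) by (simp add: not_le less_2_cases_iff)
  then show ?thesis using assms(3) by (elim card_1_singletonE) simp
qed

section \<open>Reconstruction of a poset from its Tutte polynomial\<close>

text \<open>The outermost decomposition of \<open>P\<close> forces one of the same kind on
  \<open>Q\<close>, with parts having equal Tutte polynomials. Irreducibility is available for
  \<open>P\<close> only, so the parts on that side must stay in \<open>SP_irr\<close>.\<close>

lemma poset_iso_of_tutte_eq:
  fixes P :: "'a rel" and Q :: "'b rel"
  assumes "P \<in> SP_irr" "Q \<in> SP" "tutte P = tutte Q"
  shows "poset_iso P Q"
  using assms
proof (induction "card (Field P)" arbitrary: P Q rule: less_induct)
  case less
  have P: "P \<in> SP" using less.prems by (simp add: SP_irr_SP)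
  have Q: "Q \<in> SP" by fact
  have card: "card (Field P) = card (Field Q)" using P Q less.prems(3) by (rule card_Field_eqI)
  have fpoly: "filter_poly P = filter_poly Q" using less.prems(3) by (simp add: filter_poly_def)
  from less.prems(1) show ?case
  proof cases
    case (one x)
    then have "card (Field P) = 1" by (simp add: Field_def)
    then show ?thesis using P Q card by (simp add: poset_iso_singleton SP_finite_poset)
  next
    case (ordinal A B)
    have SP: "A \<in> SP" "B \<in> SP" using ordinal by (auto intro: SP_irr_SP)
    have cP: "card (Field P) = card (Field A) + card (Field B)"
      using card_Field_Un[OF SP ordinal(4)] ordinal(1) by simp
    have pos: "0 < card (Field A)" "0 < card (Field B)" using SP by (auto intro: card_Field_pos)
    have "coeff (filter_poly P) (card (Field B)) = 1"
      using coeff_filter_poly_ordinal_sum[OF SP ordinal(4)] coeff_filter_poly[OF SP(2)] ordinal(1) by simp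
    then obtain C D where CD: "C \<in> SP" "D \<in> SP" "Field C \<inter> Field D = {}" "Q = ordinal_sum C D"
        "card (Field D) = card (Field B)"
      using ordinal_sum_split[OF Q, of "card (Field B)"] fpoly card cP pos by auto
    have "tutte A = tutte C" "tutte B = tutte D"
      using tutte_ordinal_sum_cancel[OF SP CD(1,2) ordinal(4) CD(3)] CD less.prems(3) ordinal(1) by simp_all
    then have "poset_iso A C" "poset_iso B D"
      using less.hyps[of A C] less.hyps[of B D] ordinal CD cP pos by auto
    then show ?thesis using ordinal CD by (simp add: poset_iso_ordinal_sum)
  next
    case (direct D)
    have fin: "finite D" using direct(2) by (auto intro: card_ge_0_finite)
    have DSP: "D \<subseteq> SP" using direct(3) SP_irr_SP by blast
    have sub: "\<Union>J \<in> SP_irr" "\<Union>J \<in> SP" "tutte (\<Union>J) = prod tutte J" if "J \<subseteq> D" "J \<noteq> {}" for J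
    proof -
      have "finite J" "disjoint_family_on Field J"
        using that fin direct(5) finite_subset disjoint_family_on_mono by blast+
      then show "\<Union>J \<in> SP_irr" "\<Union>J \<in> SP" "tutte (\<Union>J) = prod tutte J"
        using that direct(3,4) DSP SP_irr_Union[of J] SP_Union[of J] by blast+
    qed
    have split: "P = direct_sum (\<Union>J) (\<Union>(D - J))" "Field (\<Union>J) \<inter> Field (\<Union>(D - J)) = {}" if "J \<subseteq> D" for J
    proof -
      show "P = direct_sum (\<Union>J) (\<Union>(D - J))"
        using that direct(1) by (auto simp: direct_sum_def)
      show "Field (\<Union>J) \<inter> Field (\<Union>(D - J)) = {}"
        using that direct(5) by (fastforce simp: disjoint_family_on_def Field_Union)
    qed
    \<comment> \<open>Splitting off one component exhibits \<open>P\<close> as a binary direct sum.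
      This rules out that \<open>Q\<close> is an ordinal sum, which would have a coefficient 1 at an
      intermediate size.\<close>
    have two: "2 \<le> coeff (filter_poly P) k" if k: "0 < k" "k < card (Field P)" for k
    proof -
      obtain C where C: "C \<in> D" using direct(2) by fastforce
      have "D \<noteq> {C}" using direct(2) by auto
      then have "D - {C} \<noteq> {}" using C by blast
      then have S: "\<Union>{C} \<in> SP" "\<Union>(D - {C}) \<in> SP" using sub[of "{C}"] sub[of "D - {C}"] C by auto
      have J: "{C} \<subseteq> D" using C by simp
      have "k < card (Field (\<Union>{C})) + card (Field (\<Union>(D - {C})))"
        using k(2) card_Field_Un[OF S split(2)[OF J]] split(1)[OF J] by (metis Field_direct_sum)
      then show ?thesis
        using coeff_filter_poly_direct_sum[OF S split(2)[OF J] k(1)] split(1)[OF J] by simp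
    qed
    from Q show ?thesis
    proof (cases rule: SP_cases)
      case (one x)
      then have "card (Field P) = 1" using card by (simp add: Field_def)
      then show ?thesis using P Q card by (simp add: poset_iso_singleton SP_finite_poset)
    next
      case (ordinal A B)
      have "coeff (filter_poly P) (card (Field B)) = 1"
        using coeff_filter_poly_ordinal_sum[OF ordinal(1-3)] coeff_filter_poly[OF ordinal(2)] ordinal(4) fpoly
        by simp
      moreover have "0 < card (Field B)" "card (Field B) < card (Field P)"
        using card_Field_pos[OF ordinal(1)] card_Field_pos[OF ordinal(2)] card card_Field_Un[OF ordinal(1-3)]
          ordinal(4) by simp_all
      ultimately show ?thesis using two[of "card (Field B)"] by simp
    next
      case (direct A B)
      have "prod tutte D = tutte A * tutte B"
      proof -
        have "D \<noteq> {}" using \<open>2 \<le> card D\<close> by auto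
        then have "prod tutte D = tutte Q"
          using sub(3)[OF subset_refl] \<open>P = \<Union>D\<close> less.prems(3) by simp
        also have "\<dots> = tutte A * tutte B"
          using direct by (simp add: tutte_direct_sum SP_finite_poset)
        finally show ?thesis .
      qed
      \<comment> \<open>Unique factorization in \<open>rat poly poly\<close> makes irreducible
        elements prime.\<close>
      moreover have "prime_elem (tutte C)" if "C \<in> D" for C
        using bspec[OF \<open>\<forall>C\<in>D. irreducible (tutte C)\<close> that] by (rule irreducible_imp_prime_elem)
      ultimately obtain J u v where J: "J \<subseteq> D" "u * v = 1"
        "tutte A = u * prod tutte J" "tutte B = v * prod tutte (D - J)"
        using prod_prime_eq_mult[OF fin] by metis
      have u: "u dvd 1" "v dvd 1" using J(2) by (metis dvd_triv_left, metis dvd_triv_right)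
      have X: "var_x - 1 dvd prod tutte K - 1" if "K \<subseteq> D" for K
        using sub[OF that] tutte_minus_1_dvd by (cases "K = {}") fastforce+
      have A: "tutte A = prod tutte J"
        by (rule tutte_eq_of_associated[OF tutte_minus_1_dvd X J(3) u(1)]) (use direct J in auto)
      have B: "tutte B = prod tutte (D - J)"
        by (rule tutte_eq_of_associated[OF tutte_minus_1_dvd X J(4) u(2)]) (use direct J in auto)
      \<comment> \<open>Excludes the empty product on either side, so both \<open>J\<close> and
        \<open>D - J\<close> yield strictly smaller posets for the induction hypothesis.\<close>
      have nontriv: "tutte R \<noteq> 1" if "R \<in> SP" for R :: "'b rel"
      proof
        assume "tutte R = 1"
        then have "filter_poly R = 1" by (simp add: filter_poly_def pcompose_1)
        then show False using coeff_filter_poly[OF that] card_Field_pos[OF that] by (simp add: coeff_1)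
      qed
      have ne: "J \<noteq> {}" "D - J \<noteq> {}"
        using A B nontriv[OF direct(1)] nontriv[OF direct(2)] by (metis prod.empty)+
      have J': "D - J \<subseteq> D" by blast
      have cP: "card (Field P) = card (Field (\<Union>J)) + card (Field (\<Union>(D - J)))"
        using card_Field_Un[OF sub(2)[OF J(1) ne(1)] sub(2)[OF J' ne(2)] split(2)[OF J(1)]] split(1)[OF J(1)]
        by (metis Field_direct_sum)
      have "poset_iso (\<Union>J) A"
        using less.hyps[OF _ sub(1)[OF J(1) ne(1)] direct(1)] cP card_Field_pos[OF sub(2)[OF J' ne(2)]]
          sub(3)[OF J(1) ne(1)] A by simp
      moreover have "poset_iso (\<Union>(D - J)) B"
        using less.hyps[OF _ sub(1)[OF J' ne(2)] direct(2)] cP card_Field_pos[OF sub(2)[OF J(1) ne(1)]]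
          sub(3)[OF J' ne(2)] B by simp
      ultimately show ?thesis
        unfolding direct(4) split(1)[OF J(1)]
        by (rule poset_iso_direct_sum(1)[OF _ _ split(2)[OF J(1)] direct(3)])
    qed
  qed
qed

subsection \<open>Components of comparability graphs\<close>

text \<open>The reflexive closure is taken over the whole type, hence the carrier
  \<open>UNIV\<close>; symmetry holds because edges are unordered.\<close>

lemma equiv_reachable: "equiv UNIV (reachable G)"
proof (rule equivI)
  show "sym (reachable G)"
    unfolding reachable_def by (rule sym_rtrancl) (auto simp: sym_def insert_commute)
qed (auto simp: reachable_def refl_on_def trans_rtrancl)

lemma reachable_sym: "(u, v) \<in> reachable G \<Longrightarrow> (v, u) \<in> reachable G"
  using equiv_reachable[of G] by (blast elim: equivE dest: symD)

lemma reachable_trans: "(u, v) \<in> reachable G \<Longrightarrow> (v, w) \<in> reachable G \<Longrightarrow> (u, w) \<in> reachable G"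
  using equiv_reachable[of G] by (blast elim: equivE dest: transD)

lemma reachable_mem:
  assumes "(u, v) \<in> reachable G" "u \<in> W" "\<And>s t. {s, t} \<in> snd G \<Longrightarrow> s \<in> W \<Longrightarrow> t \<in> W"
  shows "v \<in> W"
  using assms(1) unfolding reachable_def
  by (induction rule: rtrancl_induct) (use assms in auto)

lemma reachable_Image_subset:
  assumes "u \<in> W" "\<And>s t. {s, t} \<in> snd G \<Longrightarrow> s \<in> W \<Longrightarrow> t \<in> W"
  shows "reachable G `` {u} \<subseteq> W"
  using reachable_mem[where G = G and W = W and u = u] assms by blast

lemma reachable_edge: "{u, v} \<in> snd G \<Longrightarrow> (u, v) \<in> reachable G"
  by (auto simp: reachable_def)

lemma components_iff: "C \<in> components G \<longleftrightarrow> (\<exists>u\<in>fst G. C = reachable G `` {u})"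
  by (auto simp: components_def quotient_def)

lemma in_component: "u \<in> reachable G `` {u}"
  by (simp add: reachable_def)

lemma components_disjoint:
  assumes "C \<in> components G" "C' \<in> components G" "C \<noteq> C'"
  shows "C \<inter> C' = {}"
proof -
  have "C \<in> UNIV // reachable G" "C' \<in> UNIV // reachable G"
    using assms(1,2) unfolding components_def quotient_def by blast+
  then show ?thesis using quotient_disj[OF equiv_reachable] assms(3) by blast
qed

text \<open>Reconciles \<open>class_H\<close>, which speaks of the graph of a subposet, with
  \<open>component_family\<close>, which uses induced subgraphs.\<close>

lemma comparability_graph_Restr:
  assumes "finite_poset P" "W \<subseteq> Field P"
  shows "comparability_graph (Restr P W) = induced_subgraph (comparability_graph P) W"
  using assms Field_Restr_poset[OF assms(1), of W]
  by (auto simp: comparability_graph_def induced_subgraph_def) blast+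

lemma component_family_subset:
  assumes "W \<in> component_family P" "Field P \<noteq> {}"
  shows "W \<noteq> {} \<and> W \<subseteq> Field P"
  using assms(1)
proof induction
  case top
  then show ?case using assms(2) by simp
next
  case (step W C)
  \<comment> \<open>Stated for any graph, so that it serves the comparability graph and its
    complement alike.\<close>
  have "C \<noteq> {} \<and> C \<subseteq> W" if C: "C \<in> components (induced_subgraph G W)" for G
  proof -
    obtain u where u: "u \<in> W" "C = reachable (induced_subgraph G W) `` {u}"
      using C by (auto simp: components_iff induced_subgraph_def)
    then show ?thesis
      using reachable_mem[of u _ "induced_subgraph G W" W] in_component[of u "induced_subgraph G W"]
      by (auto simp: induced_subgraph_def)
  qed
  then show ?case using step by blast
qed

text \<open>No edge leaves \<open>Field A\<close>, so no path leads from it to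
  \<open>Field B\<close>.\<close>

lemma not_connected_direct_sum:
  assumes "A \<in> SP" "B \<in> SP" "Field A \<inter> Field B = {}"
  shows "\<not> connected_graph (comparability_graph (direct_sum A B))"
proof
  assume con: "connected_graph (comparability_graph (direct_sum A B))"
  obtain a b where ab: "a \<in> Field A" "b \<in> Field B"
    using assms(1,2)[THEN SP_finite_poset] by blast
  have "(a, b) \<in> reachable (comparability_graph (direct_sum A B))"
    using con ab by (auto simp: connected_graph_def comparability_graph_def)
  then have "b \<in> Field A"
  proof (rule reachable_mem)
    fix s t assume "{s, t} \<in> snd (comparability_graph (direct_sum A B))" "s \<in> Field A"
    then have "(s, t) \<in> direct_sum A B \<or> (t, s) \<in> direct_sum A B"
      by (auto simp: comparability_graph_def doubleton_eq_iff)
    then show "t \<in> Field A"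
      using \<open>s \<in> Field A\<close> assms(3) by (auto simp: direct_sum_def dest: FieldI1 FieldI2)
  qed (rule ab)
  then show False using ab assms(3) by blast
qed

text \<open>For connected \<open>W\<close> the family offers the components of the incomparability graph all at once,
  while \<open>SP_irr\<close> uses binary ordinal sums. The inner induction therefore runs over all unions
  \<open>U\<close> of such components.\<close>

lemma class_H_Restr_SP_irr:
  assumes P: "P \<in> class_H" and W: "W \<in> component_family P"
  shows "Restr P W \<in> SP_irr"
  using W
proof (induction "card W" arbitrary: W rule: less_induct)
  case less
  have PSP: "P \<in> SP" using P by (simp add: class_H_def)
  have fp: "finite_poset P" and ne: "Field P \<noteq> {}" using SP_finite_poset[OF PSP] by auto
  have W: "W \<noteq> {}" "W \<subseteq> Field P" using component_family_subset[OF less.prems ne] by auto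
  have finW: "finite W" using W(2) fp finite_subset finite_poset_finite by blast
  have F: "Field (Restr P U) = U" if "U \<subseteq> Field P" for U
    using Field_Restr_poset[OF fp] that by blast
  have RSP: "Restr P U \<in> SP" if "U \<subseteq> Field P" "U \<noteq> {}" for U
    using SP_Restr[OF PSP] that by blast
  let ?G = "comparability_graph (Restr P W)"
  have G: "?G = induced_subgraph (comparability_graph P) W"
    using fp W(2) by (rule comparability_graph_Restr)
  have fstG: "fst ?G = W" using F[OF W(2)] by (simp add: comparability_graph_def)
  show ?case
  proof (cases "connected_graph ?G")
    case False
    let ?D = "Restr P ` components ?G"
    have fam: "C \<in> component_family P" if "C \<in> components ?G" for C
      using less.prems that G by (auto intro: component_family.step)
    have CW: "C \<subseteq> W" if C: "C \<in> components ?G" for C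
    proof -
      obtain u where u: "u \<in> W" "C = reachable ?G `` {u}"
        using C fstG by (auto simp: components_iff)
      show ?thesis using reachable_mem[of u _ ?G W] u by (auto simp: G induced_subgraph_def)
    qed
    have CF: "C \<subseteq> Field P" if "C \<in> components ?G" for C using CW[OF that] W(2) by blast
    have proper: "C \<noteq> W" if C: "C \<in> components ?G" for C
    proof
      assume "C = W"
      obtain u where u: "W = reachable ?G `` {u}"
        using C \<open>C = W\<close> by (auto simp: components_iff)
      have "(x, y) \<in> reachable ?G" if "x \<in> W" "y \<in> W" for x y
      proof -
        have "(u, x) \<in> reachable ?G" "(u, y) \<in> reachable ?G" using that u by blast+
        then show ?thesis by (blast intro: reachable_sym reachable_trans)
      qed
      then show False using False W(1) fstG by (simp add: connected_graph_def)
    qed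
    have comp: "\<exists>C\<in>components ?G. w \<in> C" if "w \<in> W" for w
    proof
      show "reachable ?G `` {w} \<in> components ?G" using that fstG by (auto simp: components_iff)
    qed (rule in_component)
    have irr: "Restr P C \<in> SP_irr" "irreducible (tutte (Restr P C))" if "C \<in> components ?G" for C
    proof -
      have "card C < card W"
        using CW[OF that] proper[OF that] finW by (simp add: psubset_card_mono psubsetI)
      then show "Restr P C \<in> SP_irr" using less.hyps fam[OF that] by blast
      show "irreducible (tutte (Restr P C))"
      proof -
        have "Restr (Restr P W) C = Restr P C" using CW[OF that] by blast
        then show ?thesis using P less.prems False that by (auto simp: class_H_def)
      qed
    qed
    have "finite (components ?G)"
      using finW by (rule finite_subset[rotated, OF finite_Pow_iff[THEN iffD2]]) (use CW in blast)
    moreover have "\<Union>?D = Restr P W"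
    proof -
      have "(s, t) \<in> \<Union>?D" if st: "(s, t) \<in> Restr P W" for s t
      proof -
        obtain C where C: "C \<in> components ?G" "s \<in> C" using comp st by blast
        have "t \<in> C"
        proof (cases "s = t")
          case False
          then have "(s, t) \<in> reachable ?G"
            using st by (intro reachable_edge) (auto simp: comparability_graph_def)
          then show ?thesis
            using C by (auto simp: components_iff intro: reachable_trans)
        qed (use C in simp)
        then show ?thesis using C st by auto
      qed
      moreover have "\<Union>?D \<subseteq> Restr P W" using CW by blast
      ultimately show ?thesis by auto
    qed
    moreover have "disjoint_family_on Field ?D"
      unfolding disjoint_family_on_def using components_disjoint F CF by (metis (no_types, lifting) imageE)
    moreover have "?D \<noteq> {}" using comp W(1) by blast
    ultimately show ?thesis
      using irr SP_irr_Union[of ?D] by (metis (no_types, lifting) finite_imageI image_subsetI imageE)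
  next
    case True
    let ?H = "induced_subgraph (complement_graph (comparability_graph P)) W"
    have fstH: "fst ?H = W" by (simp add: induced_subgraph_def)
    have comparable: "{s, t} \<in> snd (comparability_graph P) \<longleftrightarrow> s \<noteq> t \<and> ((s, t) \<in> P \<or> (t, s) \<in> P)" for s t
      by (auto simp: comparability_graph_def doubleton_eq_iff)
    \<comment> \<open>Reflexivity of \<open>P\<close> makes the condition that \<open>s\<close> and
      \<open>t\<close> differ implicit.\<close>
    have edge: "{s, t} \<in> snd ?H \<longleftrightarrow> s \<in> W \<and> t \<in> W \<and> (s, t) \<notin> P \<and> (t, s) \<notin> P" for s t
    proof -
      have "{s, t} \<in> snd ?H \<longleftrightarrow> s \<in> W \<and> t \<in> W \<and> s \<in> Field P \<and> t \<in> Field P \<and> s \<noteq> t \<and>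
          {s, t} \<notin> snd (comparability_graph P)"
        by (auto simp: induced_subgraph_def complement_graph_def doubleton_eq_iff insert_commute
            comparability_graph_def[THEN arg_cong, of fst])
      then show ?thesis using W(2) finite_poset_refl[OF fp] by (auto simp: comparable)
    qed
    have fam: "C \<in> component_family P" if "C \<in> components ?H" for C
      using less.prems that by (auto intro: component_family.step)
    from RSP[OF W(2,1)] show ?thesis
    proof (cases rule: SP_cases)
      case (one x)
      then show ?thesis by (simp add: SP_irr.one)
    next
      case (direct A B)
      then show ?thesis using True not_connected_direct_sum[OF direct(1-3)] by simp
    next
      case (ordinal A B)
      have FAB: "W = Field A \<union> Field B" using ordinal(4) F[OF W(2)] by simp
      have AB: "a \<in> Field A \<Longrightarrow> b \<in> Field B \<Longrightarrow> (a, b) \<in> P" for a b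
        using ordinal(4) by (auto simp: ordinal_sum_def)
      have ABne: "Field A \<noteq> {}" "Field B \<noteq> {}" using ordinal SP_finite_poset by blast+
      \<comment> \<open>Every element of \<open>A\<close> is comparable with every element of
        \<open>B\<close>, so a component of the incomparability graph stays within one of the two
        parts. The outer induction hypothesis thus applies to it.\<close>
      have proper: "C \<subset> W" if C: "C \<in> components ?H" for C
      proof -
        obtain u where u: "u \<in> W" "C = reachable ?H `` {u}"
          using C fstH by (auto simp: components_iff)
        have "C \<subseteq> Field A \<or> C \<subseteq> Field B"
        proof (cases "u \<in> Field A")
          case True
          then show ?thesis
            unfolding u(2) using AB FAB by (intro disjI1 reachable_Image_subset) (unfold edge, blast+)
        next
          case False
          then have "u \<in> Field B" using u(1) FAB by blast
          then show ?thesis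
            unfolding u(2) using AB FAB by (intro disjI2 reachable_Image_subset) (unfold edge, blast+)
        qed
        then show ?thesis using FAB ABne ordinal(3) by blast
      qed
      \<comment> \<open>Closure under edges of \<open>?H\<close> expresses that \<open>U\<close> is
        a union of its components.\<close>
      have "Restr P U \<in> SP_irr"
        if "U \<subseteq> W" "U \<noteq> {}" "\<And>s t. {s, t} \<in> snd ?H \<Longrightarrow> s \<in> U \<Longrightarrow> t \<in> U" for U
        using that
      proof (induction "card U" arbitrary: U rule: less_induct)
        case U: less
        have UP: "U \<subseteq> Field P" using U.prems(1) W(2) by blast
        show ?case
        proof (cases "U \<in> components ?H")
          case True
          then show ?thesis using less.hyps[OF _ fam] proper finW by (simp add: psubset_card_mono)
        next
          case notcomp: False
          have reach: "reachable ?H `` {u} \<subseteq> U" if "u \<in> U" for u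
            using that U.prems(3) by (rule reachable_Image_subset)
          have notall: "\<exists>v\<in>U. (u, v) \<notin> reachable ?H" if "u \<in> U" for u
            using reach[OF that] notcomp that U.prems(1) fstH by (auto simp: components_iff)
          from RSP[OF UP U.prems(2)] show ?thesis
          proof (cases rule: SP_cases)
            case (one x)
            then show ?thesis by (simp add: SP_irr.one)
          next
            case (direct A' B')
            have FU: "U = Field A' \<union> Field B'" using direct(4) F[OF UP] by simp
            \<comment> \<open>Elements of different direct summands are incomparable, hence adjacent
              in \<open>?H\<close>. Passing through the other summand then connects all of
              \<open>U\<close>, contradicting that \<open>U\<close> is not a single
              component.\<close>
            have inc: "(a, b) \<in> reachable ?H" "(b, a) \<in> reachable ?H"
              if "a \<in> Field A'" "b \<in> Field B'" for a b
            proof -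
              have "(a, b) \<notin> Restr P U" "(b, a) \<notin> Restr P U"
                using that direct(3) unfolding direct(4) direct_sum_def by (auto dest: FieldI1 FieldI2)
              then have "{a, b} \<in> snd ?H" using that FU U.prems(1) by (auto simp: edge)
              then show "(a, b) \<in> reachable ?H" "(b, a) \<in> reachable ?H"
                by (auto intro!: reachable_edge simp: insert_commute)
            qed
            obtain a b where ab: "a \<in> Field A'" "b \<in> Field B'"
              using direct(1,2)[THEN SP_finite_poset] by blast
            have "(a, v) \<in> reachable ?H" if "v \<in> U" for v
              using that inc ab FU by (blast intro: reachable_trans)
            then show ?thesis using notall[of a] ab FU by blast
          next
            case (ordinal A' B')
            have FU: "U = Field A' \<union> Field B'" using ordinal(4) F[OF UP] by simp
            have cmp: "(a, b) \<in> P" if "a \<in> Field A'" "b \<in> Field B'" for a b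
              using that ordinal(4) by (auto simp: ordinal_sum_def)
            have ne': "Field A' \<noteq> {}" "Field B' \<noteq> {}"
              using ordinal(1,2)[THEN SP_finite_poset] by blast+
            have finU: "finite U" using U.prems(1) finW finite_subset by blast
            have eq: "Restr P (Field A') = A'" "Restr P (Field B') = B'"
            proof -
              have "A' = Restr (Restr P U) (Field A')" "B' = Restr (Restr P U) (Field B')"
                using ordinal(3) unfolding ordinal(4) ordinal_sum_def by (auto dest: FieldI1 FieldI2)
              moreover have "Restr (Restr P U) V = Restr P V" if "V \<subseteq> U" for V
                using that by blast
              ultimately show "Restr P (Field A') = A'" "Restr P (Field B') = B'" using FU by simp_all
            qed
            \<comment> \<open>No edge of \<open>?H\<close> joins \<open>A'\<close> and
              \<open>B'\<close>, so each of them is again closed under edges and the inner induction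
              hypothesis applies.\<close>
            have "Restr P (Field A') \<in> SP_irr"
            proof (rule U.hyps)
              show "card (Field A') < card U"
                using finU FU ne' ordinal(3) by (intro psubset_card_mono) auto
              show "t \<in> Field A'" if "{s, t} \<in> snd ?H" "s \<in> Field A'" for s t
                using U.prems(3)[OF that(1)] that cmp FU by (auto simp: edge)
            qed (use FU U.prems ne' in auto)
            moreover have "Restr P (Field B') \<in> SP_irr"
            proof (rule U.hyps)
              show "card (Field B') < card U"
                using finU FU ne' ordinal(3) by (intro psubset_card_mono) auto
              show "t \<in> Field B'" if "{s, t} \<in> snd ?H" "s \<in> Field B'" for s t
                using U.prems(3)[OF that(1)] that cmp FU by (auto simp: edge)
            qed (use FU U.prems ne' in auto)
            ultimately show ?thesis
              unfolding ordinal(4) eq using ordinal(3) by (rule SP_irr.ordinal)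
          qed
        qed
      qed
      then show ?thesis using W(1) by (auto simp: edge)
    qed
  qed
qed

theorem theorem1p4:
  fixes P :: "'a rel" and Q :: "'b rel"
  assumes "P \<in> class_H" and "Q \<in> SP"
  shows "tutte P = tutte Q \<longleftrightarrow> poset_iso P Q"
proof
  have P: "P \<in> SP" using assms(1) by (simp add: class_H_def)
  have "Restr P (Field P) = P" by (auto intro: FieldI1 FieldI2)
  then have "P \<in> SP_irr"
    using class_H_Restr_SP_irr[OF assms(1) component_family.top] by simp
  then show "poset_iso P Q" if "tutte P = tutte Q"
    using assms(2) that by (rule poset_iso_of_tutte_eq)
  show "tutte P = tutte Q" if "poset_iso P Q"
    using that SP_finite_poset[OF P] by (simp add: tutte_iso)
qed

end
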